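(* Let $d\ge 1$. Then: (1) for $3\le q\le d+1$, $X^d_q$ is topologically mixing but not strongly irreducible (with any gap); (2) for $d+2\le q\le 2d$, $X^d_q$ has the finite extension property with some distance, but is not topologically strong spatial mixing (with any gap); (3) for $q\ge 2d+1$, $X^d_q$ is topologically strong spatial mixing (with some gap).
   Context: $\mathbb{Z}^d$ is the lattice graph (vertices adjacent iff they differ by a standard unit vector). $X^d_q$ is the set of proper $q$-colorings of $\mathbb{Z}^d$ with colors $\{1,\dots,q\}$. For nonempty $U,V\subseteq\mathbb{Z}^d$, $\mathrm{dist}(U,V)=\min_{\vec i\in U,\vec j\in V}|\vec i-\vec j|_1$; $B_n^d=\{-n,\dots,n\}^d$. Properties: (TM) $X^d_q$ is topologically mixing if for all finite $U,V\subseteq\mathbb{Z}^d$ there is $n\in\mathbb{N}$ such that for all $\vec i\in\mathbb{Z}^d$ with $\mathrm{dist}(U+\vec i,V)\ge n$ and all $x,y\in X^d_q$ there is $z\in X^d_q$ with $z|_{U+\vec i}=x|_{U+\vec i}$ and $z|_V=y|_V$. (SI) $X^d_q$ is strongly irreducible with gap $n$ if for all $x,y\in X^d_q$ and $U,V\subseteq\mathbb{Z}^d$ with $\mathrm{dist}(U,V)\ge n$ there is $z\in X^d_q$ with $z|_U=x|_U$ and $z|_V=y|_V$; it is SI if this holds for some $n$. (FEP) $X^d_q$ has the finite extension property with distance $n$ if for every $U\subseteq\mathbb{Z}^d$ and every proper coloring $u$ of $U$ with colors in $\{1,\dots,q\}$ that extends to a proper $q$-coloring of $U+B_n^d$, $u$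 extends to a proper $q$-coloring of $\mathbb{Z}^d$. (TSSM) $X^d_q$ is topologically strong spatial mixing with gap $n$ if for all $x,y\in X^d_q$ and $U,V,W\subseteq\mathbb{Z}^d$ with $\mathrm{dist}(U,V)\ge n$ and $x|_W=y|_W$, there is $z\in X^d_q$ with $z|_{U\cup W}=x|_{U\cup W}$ and $z|_{V\cup W}=y|_{V\cup W}$. *)

theory Defs
  imports "HOL-Analysis.Finite_Cartesian_Product"
begin

text \<open>
  The lattice \<open>Z^d\<close> is the type \<^typ>\<open>int ^ 'd\<close> with \<open>d = CARD('d)\<close>; since \<open>'d\<close> is an arbitrary
  finite type (and types are nonempty), \<open>d\<close> ranges over all integers \<open>\<ge> 1\<close>.
\<close>

definition lattice_adj :: "int ^ 'd \<Rightarrow> int ^ 'd \<Rightarrow> bool" where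
  "lattice_adj i j \<longleftrightarrow> (\<exists>k. j = i + axis k 1 \<or> i = j + axis k 1)"

text \<open>
  A coloring of \<open>U\<close> is represented by a total function of which only the values on \<open>U\<close> matter.
\<close>

definition proper_coloring_on :: "nat \<Rightarrow> (int ^ 'd) set \<Rightarrow> (int ^ 'd \<Rightarrow> nat) \<Rightarrow> bool" where
  "proper_coloring_on q U u \<longleftrightarrow>
     (\<forall>i\<in>U. u i \<in> {1..q}) \<and> (\<forall>i\<in>U. \<forall>j\<in>U. lattice_adj i j \<longrightarrow> u i \<noteq> u j)"

definition colorings :: "nat \<Rightarrow> (int ^ 'd \<Rightarrow> nat) set" where
  "colorings q = {x. proper_coloring_on q UNIV x}"

definition agree_on :: "(int ^ 'd) set \<Rightarrow> (int ^ 'd \<Rightarrow> nat) \<Rightarrow> (int ^ 'd \<Rightarrow> nat) \<Rightarrow> bool" where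
  "agree_on U x y \<longleftrightarrow> (\<forall>i\<in>U. x i = y i)"

definition l1_dist :: "int ^ 'd::finite \<Rightarrow> int ^ 'd \<Rightarrow> nat" where
  "l1_dist i j = (\<Sum>k\<in>UNIV. nat \<bar>i $ k - j $ k\<bar>)"

text \<open>
  For nonempty \<open>U\<close> and \<open>V\<close> the infimum of this set of natural numbers is attained, hence a minimum.
  The distance is only meaningful in that case, so the properties below are stated for
  nonempty \<open>U\<close> and \<open>V\<close> (if either is empty, each of them holds trivially).
\<close>

definition set_dist :: "(int ^ 'd::finite) set \<Rightarrow> (int ^ 'd) set \<Rightarrow> nat" where
  "set_dist U V = Inf {l1_dist i j | i j. i \<in> U \<and> j \<in> V}"

definition translate :: "(int ^ 'd) set \<Rightarrow> int ^ 'd \<Rightarrow> (int ^ 'd) set" where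
  "translate U i = (\<lambda>u. u + i) ` U"

definition box :: "nat \<Rightarrow> (int ^ 'd) set" where
  "box n = {b. \<forall>k. b $ k \<in> {- int n..int n}}"

definition thicken :: "(int ^ 'd) set \<Rightarrow> nat \<Rightarrow> (int ^ 'd) set" where
  "thicken U n = {u + b | u b. u \<in> U \<and> b \<in> box n}"

definition topologically_mixing :: "(int ^ 'd::finite \<Rightarrow> nat) set \<Rightarrow> bool" where
  "topologically_mixing X \<longleftrightarrow>
     (\<forall>U V. finite U \<and> U \<noteq> {} \<and> finite V \<and> V \<noteq> {} \<longrightarrow>
       (\<exists>n. \<forall>i. set_dist (translate U i) V \<ge> n \<longrightarrow>
         (\<forall>x\<in>X. \<forall>y\<in>X. \<exists>z\<in>X. agree_on (translate U i) z x \<and> agree_on V z y)))"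

definition strongly_irreducible :: "(int ^ 'd::finite \<Rightarrow> nat) set \<Rightarrow> nat \<Rightarrow> bool" where
  "strongly_irreducible X n \<longleftrightarrow>
     (\<forall>x\<in>X. \<forall>y\<in>X. \<forall>U V. U \<noteq> {} \<and> V \<noteq> {} \<and> set_dist U V \<ge> n \<longrightarrow>
       (\<exists>z\<in>X. agree_on U z x \<and> agree_on V z y))"

definition finite_extension_property :: "'d::finite itself \<Rightarrow> nat \<Rightarrow> nat \<Rightarrow> bool" where
  "finite_extension_property TYPE('d) q n \<longleftrightarrow>
     (\<forall>(U :: (int ^ 'd) set) u.
       proper_coloring_on q U u \<and>
       (\<exists>v. proper_coloring_on q (thicken U n) v \<and> agree_on U v u) \<longrightarrow>
       (\<exists>z \<in> colorings q. agree_on U z u))"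

definition topologically_strong_spatial_mixing ::
    "(int ^ 'd::finite \<Rightarrow> nat) set \<Rightarrow> nat \<Rightarrow> bool" where
  "topologically_strong_spatial_mixing X n \<longleftrightarrow>
     (\<forall>x\<in>X. \<forall>y\<in>X. \<forall>U V W.
       U \<noteq> {} \<and> V \<noteq> {} \<and> set_dist U V \<ge> n \<and> agree_on W x y \<longrightarrow>
       (\<exists>z\<in>X. agree_on (U \<union> W) z x \<and> agree_on (V \<union> W) z y))"

end

theory Submission
  imports Defs
begin

text \<open>
  For \<open>q \<le> d + 1\<close> a linear coloring \<open>\<Sum> c\<^sub>j v\<^sub>j mod q\<close> cannot be changed on a finite set, so
  strong irreducibility fails. Mixing holds for every \<open>q \<ge> 3\<close>: a graph homomorphism
  that fixes a large cube and collapses a far half-space to an edge turns any coloring into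
  one that is a chessboard beyond a hyperplane, and two such colorings can be glued.
  For \<open>q \<ge> d + 2\<close>, blocks of side \<open>d + 2\<close> can be filled in one after the other,
  whatever surrounds them: a block is bipartite and has an orientation whose out-degrees are below
  the sizes of the lists of available colors, so the kernel method colors it. For \<open>q \<ge> 2d + 1\<close>
  single sites can be filled in greedily. For \<open>q \<le> 2d\<close>, fixing the sites around an axis
  can force the axis to alternate between two colors, which transmits information arbitrarily far.
\<close>

section \<open>Lattice and colorings\<close>

lemma axis_1_nth [simp]: "axis k (1::int) $ j = (if j = k then 1 else 0)"
  by (simp add: axis_def)

definition coord_sum :: "int ^ 'd::finite \<Rightarrow> int" where
  "coord_sum v = (\<Sum>j\<in>UNIV. v $ j)"

lemma coord_sum_add: "coord_sum (v + w) = coord_sum v + coord_sum w"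
  by (simp add: coord_sum_def sum.distrib)

lemma coord_sum_axis [simp]: "coord_sum (axis k t) = t"
  by (simp add: coord_sum_def axis_def)

lemma lattice_adj_sym: "lattice_adj i j \<longleftrightarrow> lattice_adj j i"
  by (auto simp: lattice_adj_def)

lemma lattice_adjI:
  assumes "\<bar>i $ k - j $ k\<bar> = 1" "\<And>l. l \<noteq> k \<Longrightarrow> i $ l = j $ l"
  shows "lattice_adj i j"
proof (cases "j $ k = i $ k + 1")
  case True
  then have "j = i + axis k 1" using assms(2) by (auto simp: vec_eq_iff)
  then show ?thesis by (auto simp: lattice_adj_def)
next
  case False
  then have "i = j + axis k 1" using assms by (auto simp: vec_eq_iff)
  then show ?thesis by (auto simp: lattice_adj_def)
qed

lemma lattice_adj_step [simp]: "lattice_adj i (i + axis k 1)"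
  by (auto simp: lattice_adj_def)

lemma not_lattice_adj_refl: "\<not> lattice_adj i i"
  by (auto simp: lattice_adj_def vec_eq_iff)

lemma l1_dist_adj: "lattice_adj i j \<Longrightarrow> l1_dist i j = 1"
proof -
  have "l1_dist i (i + axis k 1) = 1" "l1_dist (i + axis k 1) i = 1" for i and k :: 'a
  proof -
    have "l1_dist i (i + axis k 1) = (\<Sum>j\<in>UNIV. if j = k then 1 else 0)"
      "l1_dist (i + axis k 1) i = (\<Sum>j\<in>UNIV. if j = k then 1 else 0)"
      unfolding l1_dist_def by (rule sum.cong; simp)+
    then show "l1_dist i (i + axis k 1) = 1" "l1_dist (i + axis k 1) i = 1" by simp_all
  qed
  then show "lattice_adj i j \<Longrightarrow> l1_dist i j = 1" by (auto simp: lattice_adj_def)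
qed

lemma l1_dist_self [simp]: "l1_dist i i = 0"
  by (simp add: l1_dist_def)

lemma set_dist_le: "i \<in> U \<Longrightarrow> j \<in> V \<Longrightarrow> set_dist U V \<le> l1_dist i j"
  unfolding set_dist_def by (rule cInf_lower) auto

lemma set_dist_ge:
  assumes "U \<noteq> {}" "V \<noteq> {}" "\<And>i j. i \<in> U \<Longrightarrow> j \<in> V \<Longrightarrow> n \<le> l1_dist i j"
  shows "n \<le> set_dist U V"
  unfolding set_dist_def by (rule cInf_greatest) (use assms in auto)

lemma colorings_iff:
  "x \<in> colorings q \<longleftrightarrow> (\<forall>i. x i \<in> {1..q}) \<and> (\<forall>i k. x i \<noteq> x (i + axis k 1))"
  unfolding colorings_def proper_coloring_on_def lattice_adj_def mem_Collect_eq by (metis UNIV_I)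

lemma coloringsI:
  assumes "\<And>i. x i \<in> {1..q}" "\<And>i k. x i \<noteq> x (i + axis k 1)"
  shows "x \<in> colorings q"
  using assms by (simp add: colorings_iff)

lemma colorings_range: "x \<in> colorings q \<Longrightarrow> x i \<in> {1..q}"
  by (simp add: colorings_iff)

lemma colorings_adj: "x \<in> colorings q \<Longrightarrow> lattice_adj i j \<Longrightarrow> x i \<noteq> x j"
  by (simp add: colorings_def proper_coloring_on_def)

lemma colorings_pullback:
  assumes "x \<in> colorings q" "\<And>i k. lattice_adj (h i) (h (i + axis k 1))"
  shows "(\<lambda>v. x (h v)) \<in> colorings q"
  by (rule coloringsI) (use colorings_range[OF assms(1)] colorings_adj[OF assms] in auto)

text \<open>Enumerating \<open>A\<close> and reducing modulo \<open>m\<close> reaches every residue.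
  It serves to spread a whole palette over the lattice directions.\<close>

lemma ex_onto_lessThan:
  assumes "finite A" "0 < m" "m \<le> card A"
  shows "\<exists>f. f ` A = {..<m::nat}"
proof -
  obtain h where h: "bij_betw h A {0..<card A}" using ex_bij_betw_finite_nat[OF assms(1)] by blast
  have "(\<lambda>a. h a mod m) ` A = (\<lambda>n. n mod m) ` (h ` A)" by (simp add: image_image)
  also have "h ` A = {0..<card A}" using h by (simp add: bij_betw_def)
  also have "(\<lambda>n. n mod m) ` {0..<card A} = {..<m}"
  proof (intro equalityI subsetI)
    show "n \<in> (\<lambda>n. n mod m) ` {0..<card A}" if "n \<in> {..<m}" for n
      using that assms by (intro image_eqI[of _ _ n]) auto
  qed (use assms in auto)
  finally show ?thesis by blast
qed

section \<open>Greedy extension\<close>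

text \<open>The countably many fibres of \<open>\<beta>\<close> are filled in the order of their
  codes, and the stages stabilise pointwise. \<open>\<beta>\<close> will be \<open>id\<close> for
  single sites and \<open>block_index\<close> for blocks.\<close>

lemma extend_by_blocks:
  fixes \<beta> :: "int ^ 'd::finite \<Rightarrow> 'b::countable"
  assumes ext: "\<And>t S c. \<lbrakk>proper_coloring_on q S c; S \<inter> \<beta> -` {t} = {}\<rbrakk> \<Longrightarrow>
      \<exists>c'. proper_coloring_on q (S \<union> \<beta> -` {t}) c' \<and> agree_on S c' c"
    and c0: "proper_coloring_on q (\<beta> -` T) c0"
  shows "\<exists>z \<in> colorings q. agree_on (\<beta> -` T) z c0"
proof -
  define S where "S n = \<beta> -` T \<union> {v. to_nat (\<beta> v) < n}" for n
  have step: "\<exists>c'. proper_coloring_on q (S (Suc n)) c' \<and> agree_on (S n) c' c"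
    if c: "proper_coloring_on q (S n) c" for n c
  proof (cases "\<exists>t. to_nat t = n \<and> t \<notin> T")
    case True
    then obtain t where t: "to_nat t = n" "t \<notin> T" by blast
    have "S n \<inter> \<beta> -` {t} = {}" using t by (auto simp: S_def)
    moreover have "S (Suc n) = S n \<union> \<beta> -` {t}" using t by (auto simp: S_def less_Suc_eq)
    ultimately show ?thesis using ext[OF c] by simp
  next
    case False
    then have "S (Suc n) = S n" by (auto simp: S_def less_Suc_eq)
    then show ?thesis using c by (auto simp: agree_on_def)
  qed
  have "\<exists>f. \<forall>n. (proper_coloring_on q (S n) (f n) \<and> (n = 0 \<longrightarrow> f n = c0)) \<and> agree_on (S n) (f (Suc n)) (f n)"
  proof (rule dependent_nat_choice)
    show "\<exists>x. proper_coloring_on q (S 0) x \<and> (0 = (0::nat) \<longrightarrow> x = c0)"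
      using c0 by (simp add: S_def)
  qed (use step in auto)
  then obtain f where f: "\<And>n. proper_coloring_on q (S n) (f n)" "f 0 = c0"
      "\<And>n. agree_on (S n) (f (Suc n)) (f n)" by blast
  have S_mono: "S m \<subseteq> S n" if "m \<le> n" for m n using that by (auto simp: S_def)
  have stable: "f n v = f m v" if "m \<le> n" "v \<in> S m" for m n v
    using that(1)
  proof (induction rule: dec_induct)
    case (step n)
    then have "v \<in> S n" using S_mono that(2) by blast
    then show ?case using f(3)[of n] step by (simp add: agree_on_def)
  qed simp
  \<comment> \<open>This stage is the first that is sure to contain \<open>v\<close>; later ones
    keep its value.\<close>
  define z where "z v = f (Suc (to_nat (\<beta> v))) v" for v
  have inS: "v \<in> S (Suc (to_nat (\<beta> v)))" for v by (simp add: S_def)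
  have z: "z v = f n v" if "Suc (to_nat (\<beta> v)) \<le> n" for n v
    using stable[OF that inS] by (simp add: z_def)
  have "z \<in> colorings q"
    unfolding colorings_def proper_coloring_on_def mem_Collect_eq
  proof (intro conjI ballI impI)
    fix i j :: "int ^ 'd"
    show "z i \<in> {1..q}" using f(1) inS unfolding z_def proper_coloring_on_def by blast
    assume "lattice_adj i j"
    define n where "n = Suc (max (to_nat (\<beta> i)) (to_nat (\<beta> j)))"
    have "i \<in> S n" "j \<in> S n" by (auto simp: S_def n_def)
    then have "f n i \<noteq> f n j" using f(1) \<open>lattice_adj i j\<close> unfolding proper_coloring_on_def by blast
    then show "z i \<noteq> z j" using z[of i n] z[of j n] by (simp add: n_def)
  qed
  moreover have "agree_on (\<beta> -` T) z c0"
    unfolding agree_on_def z_def using stable[of 0] by (auto simp: S_def f(2))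
  ultimately show ?thesis by blast
qed

section \<open>Lattice degree and strong spatial mixing for many colors\<close>

lemma neighbours_eq: "{w. lattice_adj v w} = (\<lambda>(k, b). v + axis k (if b then 1 else - 1)) ` UNIV"
proof (intro set_eqI iffI)
  fix w assume "w \<in> {w. lattice_adj v w}"
  then obtain k where "w = v + axis k 1 \<or> v = w + axis k 1" by (auto simp: lattice_adj_def)
  then have "w = v + axis k 1 \<or> w = v + axis k (- 1)" by (auto simp: vec_eq_iff axis_def)
  then show "w \<in> (\<lambda>(k, b). v + axis k (if b then 1 else - 1)) ` UNIV"
  proof
    show ?thesis if "w = v + axis k 1" by (rule image_eqI[of _ _ "(k, True)"]) (simp_all add: that)
    show ?thesis if "w = v + axis k (- 1)" by (rule image_eqI[of _ _ "(k, False)"]) (simp_all add: that)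
  qed
next
  fix w assume "w \<in> (\<lambda>(k, b). v + axis k (if b then 1 else - 1)) ` UNIV"
  then obtain k and b :: bool where w: "w = v + axis k (if b then 1 else - 1)" by auto
  show "w \<in> {w. lattice_adj v w}"
    unfolding mem_Collect_eq by (rule lattice_adjI[of _ k]) (auto simp: w axis_def)
qed

lemma finite_neighbours: "finite {w :: int ^ 'd::finite. lattice_adj v w}"
  unfolding neighbours_eq by simp

lemma card_neighbours_le: "card {w :: int ^ 'd::finite. lattice_adj v w} \<le> 2 * CARD('d)"
  unfolding neighbours_eq
  by (rule order_trans[OF card_image_le]) (simp_all add: card_cartesian_product flip: UNIV_Times_UNIV)

text \<open>Gap 2 makes \<open>U\<close> and \<open>V\<close> disjoint and nonadjacent, so
  \<open>x\<close> on \<open>U \<union> W\<close> and \<open>y\<close> on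
  \<open>V \<union> W\<close> form one proper partial coloring. Any further site has at most 2d
  neighbours, which cannot use up \<open>q\<close> colors.\<close>

lemma tssm_colorings:
  assumes q: "2 * CARD('d::finite) + 1 \<le> q"
  shows "topologically_strong_spatial_mixing (colorings q :: (int ^ 'd \<Rightarrow> nat) set) 2"
  unfolding topologically_strong_spatial_mixing_def
proof (intro ballI allI impI)
  fix x y :: "int ^ 'd \<Rightarrow> nat" and U V W :: "(int ^ 'd) set"
  assume x: "x \<in> colorings q" and y: "y \<in> colorings q"
    and asm: "U \<noteq> {} \<and> V \<noteq> {} \<and> 2 \<le> set_dist U V \<and> agree_on W x y"
  have dist: "2 \<le> l1_dist i j" if "i \<in> U" "j \<in> V" for i j
    using set_dist_le[OF that] asm by linarith
  define c where "c i = (if i \<in> U \<union> W then x i else y i)" for i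
  have cy: "c i = y i" if "i \<in> V \<union> W" for i
    using that asm dist[of i i] by (auto simp: c_def agree_on_def)
  have "\<exists>c'. proper_coloring_on q (S \<union> id -` {t}) c' \<and> agree_on S c' c"
    if c: "proper_coloring_on q S c" and t: "S \<inter> id -` {t} = {}" for S t and c :: "int ^ 'd \<Rightarrow> nat"
  proof -
    have "card (c ` {w. lattice_adj t w}) \<le> 2 * CARD('d)"
      using card_image_le[OF finite_neighbours] card_neighbours_le by (rule order_trans)
    then have "card (c ` {w. lattice_adj t w}) < card {1..q}" using q by simp
    then obtain a where a: "a \<in> {1..q}" "a \<notin> c ` {w. lattice_adj t w}"
      by (meson card_mono finite_imageI finite_neighbours leD subsetI)
    show ?thesis
    proof (intro exI conjI)
      show "proper_coloring_on q (S \<union> id -` {t}) (c(t := a))"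
        unfolding proper_coloring_on_def
      proof (intro conjI ballI impI)
        fix i j assume ij: "i \<in> S \<union> id -` {t}" "j \<in> S \<union> id -` {t}"
        show "(c(t := a)) i \<in> {1..q}" using c a(1) ij by (auto simp: proper_coloring_on_def)
        assume adj: "lattice_adj i j"
        have ta: "c w \<noteq> a" if "lattice_adj t w" for w using a(2) that by blast
        consider "i = t" "j \<noteq> t" | "i \<noteq> t" "j = t" | "i \<noteq> t" "j \<noteq> t"
          using adj not_lattice_adj_refl by blast
        then show "(c(t := a)) i \<noteq> (c(t := a)) j"
        proof cases
          case 1
          then show ?thesis using ta[of j] adj by auto
        next
          case 2
          then show ?thesis using ta[of i] adj lattice_adj_sym[of i j] by auto
        next
          case 3
          then show ?thesis using c adj ij by (auto simp: proper_coloring_on_def)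
        qed
      qed
      show "agree_on S (c(t := a)) c" using t by (auto simp: agree_on_def)
    qed
  qed
  moreover have "proper_coloring_on q (id -` (U \<union> V \<union> W)) c"
    unfolding proper_coloring_on_def
  proof (intro conjI ballI impI)
    show "c i \<in> {1..q}" for i using colorings_range[OF x] colorings_range[OF y] by (simp add: c_def)
    fix i j assume i: "i \<in> id -` (U \<union> V \<union> W)" and j: "j \<in> id -` (U \<union> V \<union> W)" and ij: "lattice_adj i j"
    have "\<not> (i \<in> U \<and> j \<in> V)" "\<not> (j \<in> U \<and> i \<in> V)"
      using dist[of i j] dist[of j i] l1_dist_adj[of i j] l1_dist_adj[of j i] lattice_adj_sym[of i j] ij by auto
    then consider "i \<in> U \<union> W" "j \<in> U \<union> W" | "i \<in> V \<union> W" "j \<in> V \<union> W"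
      using i j by auto
    then show "c i \<noteq> c j"
    proof cases
      case 1 then show ?thesis using colorings_adj[OF x ij] by (simp add: c_def)
    next
      case 2 then show ?thesis using colorings_adj[OF y ij] cy by simp
    qed
  qed
  ultimately obtain z where z: "z \<in> colorings q" "agree_on (id -` (U \<union> V \<union> W)) z c"
    using extend_by_blocks[of q id] by metis
  then have "agree_on (U \<union> W) z x" "agree_on (V \<union> W) z y"
    using cy by (auto simp: agree_on_def c_def)
  then show "\<exists>z\<in>colorings q. agree_on (U \<union> W) z x \<and> agree_on (V \<union> W) z y" using z(1) by blast
qed

section \<open>Rigid axes and frozen colorings\<close>

text \<open>A cyclic shift permutes the residues. Below, the labels around the axis site at height
  \<open>t\<close> are shifted by \<open>t\<close>.\<close>

lemma surj_mod_shift: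
  assumes "f ` A = {..<m}" "a < m"
  shows "\<exists>p\<in>A. nat ((int (f p) + t) mod int m) = a"
proof -
  have "nat ((int a - t) mod int m) \<in> f ` A" using assms by (simp add: nat_less_iff)
  then obtain p where "p \<in> A" "f p = nat ((int a - t) mod int m)" by fastforce
  then have "nat ((int (f p) + t) mod int m) = nat (int a mod int m)"
    using assms(2) by (simp add: mod_add_left_eq)
  then show ?thesis using \<open>p \<in> A\<close> assms(2) by auto
qed

text \<open>
  The sites at off-axis distance \<open>1\<close> from the axis \<open>k\<close> use up all colors but \<open>1\<close> and \<open>2\<close> around each
  site of the axis. A coloring that agrees with them must then alternate between \<open>1\<close> and \<open>2\<close> along
  the whole axis, with the phase \<open>b\<close> decided by a single site.
\<close>

lemma not_tssm_colorings:
  assumes q: "4 \<le> q" "q \<le> 2 * CARD('d::finite)"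
  shows "\<not> topologically_strong_spatial_mixing (colorings q :: (int ^ 'd \<Rightarrow> nat) set) n"
proof
  assume mix: "topologically_strong_spatial_mixing (colorings q :: (int ^ 'd \<Rightarrow> nat) set) n"
  obtain k :: 'd where True by blast
  \<comment> \<open>\<open>m\<close> counts the colors other than 1 and 2; by
    \<open>q \<le> 2 * CARD('d)\<close> the off-axis neighbours of an axis site suffice to carry all
    of them.\<close>
  define m where "m = q - 2"
  have m: "2 \<le> m" "q = m + 2" using q by (auto simp: m_def)
  have card: "card ((UNIV - {k}) \<times> (UNIV :: bool set)) = 2 * (CARD('d) - 1)"
    by (simp add: card_cartesian_product card_Diff_singleton)
  have "m \<le> 2 * (CARD('d) - 1)" "0 < m" using m q by linarith+
  then obtain f where f: "f ` ((UNIV - {k}) \<times> (UNIV :: bool set)) = {..<m}"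
    using ex_onto_lessThan[of "(UNIV - {k}) \<times> (UNIV :: bool set)" m] card by auto
  \<comment> \<open>\<open>\<rho>\<close> is the l1 distance from the axis. At distance 1,
    \<open>F\<close> reads off the label of the signed direction pointing away from the
    axis.\<close>
  define \<rho> where "\<rho> v = (\<Sum>j\<in>UNIV - {k}. \<bar>v $ j\<bar>)" for v :: "int ^ 'd"
  define F where "F v = (\<Sum>j\<in>UNIV - {k}. if v $ j = 1 then int (f (j, True))
      else if v $ j = - 1 then int (f (j, False)) else 0)" for v :: "int ^ 'd"
  \<comment> \<open>Colors from 3 on occur exactly at distance 1, where the summand
    \<open>v $ k\<close> makes them change along the axis direction. The phase \<open>b\<close>
    affects the axis only.\<close>
  define col where "col b v = (if \<rho> v = 1 then 3 + nat ((F v + v $ k) mod int m)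
      else if \<rho> v = 0 then 1 + nat ((coord_sum v + b) mod 2) else 1 + nat (coord_sum v mod 2))" for b v
  have rho_k: "\<rho> (v + axis k t) = \<rho> v" and F_k: "F (v + axis k t) = F v" for v t
  proof -
    have eq: "(v + axis k t) $ j = v $ j" if "j \<noteq> k" for j using that by (simp add: axis_def)
    show "\<rho> (v + axis k t) = \<rho> v" "F (v + axis k t) = F v"
      unfolding \<rho>_def F_def by (rule sum.cong; use eq in simp)+
  qed
  have rho_j: "\<rho> (v + axis j 1) = \<rho> v + (\<bar>v $ j + 1\<bar> - \<bar>v $ j\<bar>)" if "j \<noteq> k" for v j
  proof -
    have "\<rho> (v + axis j 1) = (\<Sum>i\<in>UNIV - {k}. \<bar>v $ i\<bar> + (if i = j then \<bar>v $ j + 1\<bar> - \<bar>v $ j\<bar> else 0))"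
      unfolding \<rho>_def by (rule sum.cong) auto
    also have "\<dots> = \<rho> v + (\<bar>v $ j + 1\<bar> - \<bar>v $ j\<bar>)"
      using that by (simp add: sum.distrib \<rho>_def)
    finally show ?thesis .
  qed
  have rho_nonneg: "0 \<le> \<rho> v" for v by (simp add: \<rho>_def sum_nonneg)
  have mod2: "nat (a mod 2) \<noteq> nat ((a + 1) mod 2)" for a :: int
  proof -
    have "a mod 2 = 0 \<and> (a + 1) mod 2 = 1 \<or> a mod 2 = 1 \<and> (a + 1) mod 2 = 0" by presburger
    then show ?thesis by auto
  qed
  have modm: "nat (a mod int m) \<noteq> nat ((a + 1) mod int m)" for a
  proof
    assume "nat (a mod int m) = nat ((a + 1) mod int m)"
    then have "a mod int m = (a + 1) mod int m" using m by (simp add: eq_nat_nat_iff)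
    then have "int m dvd 1" by (metis add_diff_cancel_left' mod_eq_dvd_iff)
    then show False using m by simp
  qed
  have modlt: "nat (a mod int m) < m" "nat (b mod 2) < 2" for a b :: int using m by (auto simp: nat_less_iff)
  have big: "3 \<le> col b w" if "\<rho> w = 1" for b w using that by (simp add: col_def)
  have small: "col b w \<le> 2" if "\<rho> w \<noteq> 1" for b w
    using that modlt(2)[of "coord_sum w + b"] modlt(2)[of "coord_sum w"] by (simp add: col_def)
  have col: "col b \<in> colorings q" for b
  proof (rule coloringsI)
    fix v
    show "col b v \<in> {1..q}"
      using modlt(1)[of "F v + v $ k"] modlt(2)[of "coord_sum v + b"] modlt(2)[of "coord_sum v"]
      by (auto simp: col_def m)
    fix j
    show "col b v \<noteq> col b (v + axis j 1)"
    proof (cases "j = k")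
      case True
      show ?thesis
        using modm[of "F v + v $ k"] mod2[of "coord_sum v + b"] mod2[of "coord_sum v"]
        by (simp add: col_def True rho_k F_k coord_sum_add add_ac)
    next
      case False
      \<comment> \<open>A step in another direction than \<open>k\<close> changes the distance by
        exactly one, so it never joins two sites at distance 1.\<close>
      then have "\<rho> (v + axis j 1) = \<rho> v + 1 \<or> \<rho> (v + axis j 1) = \<rho> v - 1"
        by (auto simp: rho_j)
      then consider "\<rho> v = 1" "\<rho> (v + axis j 1) \<noteq> 1" | "\<rho> v \<noteq> 1" "\<rho> (v + axis j 1) = 1"
        | "\<rho> v \<ge> 2" "\<rho> (v + axis j 1) \<ge> 2"
        using rho_nonneg[of v] rho_nonneg[of "v + axis j 1"] by linarith
      then show ?thesis
      proof cases
        case 1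
        then show ?thesis using big[of v b] small[of "v + axis j 1" b] by linarith
      next
        case 2
        then show ?thesis using big[of "v + axis j 1" b] small[of v b] by linarith
      next
        case 3
        then show ?thesis using mod2[of "coord_sum v"] by (simp add: col_def coord_sum_add)
      qed
    qed
  qed
  define W where "W = {v. \<rho> v = 1}"
  define e where "e t = (axis k t :: int ^ 'd)" for t
  have rho_e: "\<rho> (e t) = 0" for t by (auto simp: \<rho>_def e_def axis_def intro!: sum.neutral)
  have "n \<le> l1_dist (e 0) (e (int n))"
  proof -
    have "l1_dist (e 0) (e (int n)) = (\<Sum>j\<in>UNIV. if j = k then n else 0)"
      unfolding l1_dist_def e_def by (rule sum.cong) (auto simp: axis_def)
    then show ?thesis by simp
  qed
  then have "n \<le> set_dist {e 0} {e (int n)}" by (intro set_dist_ge) auto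
  moreover have "agree_on W (col 0) (col 1)" by (simp add: agree_on_def W_def col_def)
  ultimately obtain z where z: "z \<in> colorings q" "agree_on ({e 0} \<union> W) z (col 0)"
      "agree_on ({e (int n)} \<union> W) z (col 1)"
    using mix col unfolding topologically_strong_spatial_mixing_def by blast
  \<comment> \<open>A color above 2 at an axis site would recur at one of its neighbours in
    \<open>W\<close>, where \<open>z\<close> coincides with \<open>col 0\<close>.\<close>
  have z12: "z (e t) \<in> {1, 2}" for t
  proof (rule ccontr)
    assume "z (e t) \<notin> {1, 2}"
    then have zt: "3 \<le> z (e t)" "z (e t) - 3 < m"
      using colorings_range[OF z(1), of "e t"] by (auto simp: m)
    then obtain j b where j: "j \<noteq> k" "nat ((int (f (j, b)) + t) mod int m) = z (e t) - 3"
      using surj_mod_shift[OF f, of "z (e t) - 3" t] by auto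
    define w where "w = e t + axis j (if b then 1 else - 1)"
    have w: "w $ i = (if i = k then t else if i = j then (if b then 1 else - 1) else 0)" for i
      using j(1) by (auto simp: w_def e_def axis_def)
    have "\<rho> w = (\<Sum>i\<in>UNIV - {k}. if i = j then 1 else 0)"
      unfolding \<rho>_def by (rule sum.cong) (auto simp: w)
    then have rho: "\<rho> w = 1" using j(1) by simp
    have "F w = (\<Sum>i\<in>UNIV - {k}. if i = j then int (f (j, b)) else 0)"
      unfolding F_def by (rule sum.cong) (auto simp: w)
    then have "F w = int (f (j, b))" using j(1) by simp
    then have "col 0 w = z (e t)" using rho j(2) zt by (simp add: col_def w)
    moreover have "z w = col 0 w" using z(2) rho by (simp add: agree_on_def W_def)
    moreover have "lattice_adj (e t) w"
      by (rule lattice_adjI[of _ j]) (use j(1) in \<open>auto simp: w e_def axis_def\<close>)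
    ultimately show False using colorings_adj[OF z(1)] by metis
  qed
  \<comment> \<open>The phase of \<open>col 0\<close> at the origin propagates along the axis and
    clashes with \<open>col 1\<close> at \<open>e (int n)\<close>.\<close>
  have "z (e (int t)) = 1 + t mod 2" for t
  proof (induction t)
    case 0
    then show ?case using z(2) rho_e[of 0] by (simp add: agree_on_def col_def e_def)
  next
    case (Suc t)
    have "lattice_adj (e (int t)) (e (int (Suc t)))"
      by (rule lattice_adjI[of _ k]) (auto simp: e_def axis_def)
    then have "z (e (int t)) \<noteq> z (e (int (Suc t)))" using colorings_adj[OF z(1)] by blast
    then show ?case using Suc z12[of "int (Suc t)"] by (auto simp: mod_Suc)
  qed
  moreover have "z (e (int n)) = 1 + nat ((int n + 1) mod 2)"
    using z(3) rho_e[of "int n"] by (simp add: agree_on_def col_def e_def)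
  ultimately have "n mod 2 = nat ((int n + 1) mod 2)" by simp
  moreover have "n mod 2 = 0 \<and> (int n + 1) mod 2 = 1 \<or> n mod 2 = 1 \<and> (int n + 1) mod 2 = 0" by presburger
  ultimately show False by auto
qed

section \<open>Linear colorings and the failure of strong irreducibility\<close>

lemma finite_box: "finite (box n :: (int ^ 'd::finite) set)"
proof -
  have "(box n :: (int ^ 'd) set) \<subseteq> vec_lambda ` (\<Pi>\<^sub>E k\<in>UNIV. {- int n..int n})"
  proof
    fix b :: "int ^ 'd" assume "b \<in> box n"
    then have "vec_nth b \<in> (\<Pi>\<^sub>E k\<in>UNIV. {- int n..int n})" by (simp add: box_def PiE_def)
    then show "b \<in> vec_lambda ` (\<Pi>\<^sub>E k\<in>UNIV. {- int n..int n})"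
      by (intro image_eqI[of _ _ "vec_nth b"]) (simp_all add: vec_nth_inverse)
  qed
  then show ?thesis by (rule finite_subset) (simp add: finite_PiE)
qed

lemma finite_l1_ball: "finite {v :: int ^ 'd::finite. l1_dist u v < n}"
proof (rule finite_subset)
  show "{v. l1_dist u v < n} \<subseteq> (\<lambda>b. u - b) ` box n"
  proof
    fix v assume v: "v \<in> {v. l1_dist u v < n}"
    have "nat \<bar>u $ k - v $ k\<bar> \<le> l1_dist u v" for k
      unfolding l1_dist_def by (rule member_le_sum) auto
    then have "nat \<bar>u $ k - v $ k\<bar> < n" for k
      using v by (metis le_less_trans mem_Collect_eq)
    then have "\<bar>u $ k - v $ k\<bar> \<le> int n" for k
      by (metis less_imp_le nat_le_iff)
    then have "- int n \<le> u $ k - v $ k \<and> u $ k - v $ k \<le> int n" for k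
      by (metis abs_le_iff minus_le_iff)
    then have "u - v \<in> box n" by (simp add: box_def)
    then show "v \<in> (\<lambda>b. u - b) ` box n" by (intro image_eqI[of _ _ "u - v"]) auto
  qed
qed (simp add: finite_box)

text \<open>
  In a coloring of the form \<open>v \<mapsto> \<Sum> c\<^sub>j v\<^sub>j mod q\<close>, with coefficients running through
  all nonzero residues, already the neighbours \<open>v + e\<^sub>j\<close> of \<open>v\<close> carry all the other colors.
\<close>

lemma frozen_coloring_exists:
  assumes q: "2 \<le> q" "q \<le> CARD('d::finite) + 1"
  shows "\<exists>x \<in> colorings q. \<forall>(v :: int ^ 'd). \<forall>a\<in>{1..q}. a \<noteq> x v \<longrightarrow> (\<exists>j. x (v + axis j 1) = a)"
proof -
  obtain f :: "'d \<Rightarrow> nat" where f: "range f = {..<q - 1}"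
    using ex_onto_lessThan[of "UNIV :: 'd set" "q - 1"] q
    by (metis One_nat_def Suc_eq_plus1 finite_class.finite_UNIV le_diff_conv less_le_trans one_less_numeral_iff semiring_norm(76) zero_less_diff)
  \<comment> \<open>The coefficients run exactly through 1 to \<open>q - 1\<close>: none vanishes
    modulo \<open>q\<close>, so neighbours differ, and all occur, which freezes
    \<open>x\<close>.\<close>
  define s where "s v = (\<Sum>j\<in>UNIV. (1 + int (f j)) * v $ j)" for v :: "int ^ 'd"
  define x where "x v = 1 + nat (s v mod int q)" for v
  have s: "s (v + axis k 1) = s v + (1 + int (f k))" for v k
  proof -
    have "s (v + axis k 1) = (\<Sum>j\<in>UNIV. (1 + int (f j)) * v $ j + (if j = k then 1 + int (f k) else 0))"
      unfolding s_def by (rule sum.cong) (auto simp: algebra_simps)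
    then show ?thesis by (simp add: sum.distrib s_def)
  qed
  have x_eq: "x v = x w \<longleftrightarrow> s v mod int q = s w mod int q" for v w
    using q by (simp add: x_def eq_nat_nat_iff)
  have "x \<in> colorings q"
  proof (rule coloringsI)
    fix v k
    have "nat (s v mod int q) < q" using q by (simp add: nat_less_iff)
    then show "x v \<in> {1..q}" by (simp add: x_def)
    have "f k < q - 1" using f by blast
    then have "\<not> int q dvd 1 + int (f k)" using q zdvd_not_zless[of "1 + int (f k)" "int q"] by linarith
    then show "x v \<noteq> x (v + axis k 1)"
      unfolding x_eq s by (metis add_diff_cancel_left' dvd_minus_iff minus_diff_eq mod_eq_dvd_iff)
  qed
  moreover have "\<exists>j. x (v + axis j 1) = a" if a: "a \<in> {1..q}" "a \<noteq> x v" for v a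
  proof -
    \<comment> \<open>The increment of \<open>s\<close> that turns the color of \<open>v\<close>
      into \<open>a\<close>; it is nonzero as \<open>a \<noteq> x v\<close>, hence one of the
      coefficients.\<close>
    define \<delta> where "\<delta> = (int a - 1 - s v) mod int q"
    have sd: "(s v + \<delta>) mod int q = int a - 1"
      using a(1) by (simp add: \<delta>_def mod_add_right_eq)
    have "\<delta> \<noteq> 0"
    proof
      assume "\<delta> = 0"
      then have "x v = a" using sd a(1) by (simp add: x_def nat_diff_distrib)
      then show False using a(2) by simp
    qed
    moreover have "0 \<le> \<delta>" "\<delta> < int q" using q by (simp_all add: \<delta>_def)
    ultimately have "nat (\<delta> - 1) \<in> range f" unfolding f by (auto simp: nat_less_iff)
    then obtain j where "f j = nat (\<delta> - 1)" by (metis imageE)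
    then have "1 + int (f j) = \<delta>" using \<open>0 \<le> \<delta>\<close> \<open>\<delta> \<noteq> 0\<close> by simp
    then have "x (v + axis j 1) = a" using sd a(1) by (simp add: x_def s nat_diff_distrib)
    then show ?thesis by blast
  qed
  ultimately show ?thesis by blast
qed

text \<open>The unit translate \<open>y\<close> of a frozen \<open>x\<close> differs from it at 0.
  If \<open>z\<close> follows \<open>y\<close> at 0 and \<open>x\<close> far away, the set where
  \<open>z\<close> and \<open>x\<close> differ is finite; at a site of it with maximal coordinate
  sum, all forward neighbours still follow \<open>x\<close>, and one of them has the color that
  \<open>z\<close> uses at the site.\<close>

lemma not_strongly_irreducible_colorings:
  assumes q: "2 \<le> q" "q \<le> CARD('d::finite) + 1"
  shows "\<not> strongly_irreducible (colorings q :: (int ^ 'd \<Rightarrow> nat) set) n"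
proof
  assume mix: "strongly_irreducible (colorings q :: (int ^ 'd \<Rightarrow> nat) set) n"
  obtain x :: "int ^ 'd \<Rightarrow> nat" where x: "x \<in> colorings q"
      and frozen: "\<And>v a. a \<in> {1..q} \<Longrightarrow> a \<noteq> x v \<Longrightarrow> \<exists>j. x (v + axis j 1) = a"
    using frozen_coloring_exists[OF q] by blast
  obtain k :: 'd where True by blast
  define y where "y v = x (v + axis k 1)" for v
  have y: "y \<in> colorings q"
    unfolding y_def by (rule colorings_pullback[OF x]) (auto simp: lattice_adj_def algebra_simps)
  define V where "V = {v :: int ^ 'd. n \<le> l1_dist 0 v}"
  have "n \<le> l1_dist 0 (axis k (int n) :: int ^ 'd)"
  proof -
    have "l1_dist 0 (axis k (int n) :: int ^ 'd) = (\<Sum>j\<in>UNIV. if j = k then n else 0)"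
      unfolding l1_dist_def by (rule sum.cong) (auto simp: axis_def)
    then show ?thesis by simp
  qed
  then have "V \<noteq> {}" by (auto simp: V_def)
  moreover from this have "n \<le> set_dist {0} V" by (intro set_dist_ge) (auto simp: V_def)
  ultimately obtain z where z: "z \<in> colorings q" "agree_on {0} z y" "agree_on V z x"
    using mix x y unfolding strongly_irreducible_def by (metis insert_not_empty)
  define E where "E = {v. z v \<noteq> x v}"
  have "z 0 = y 0" using z(2) by (simp add: agree_on_def)
  also have "y 0 \<noteq> x 0" using colorings_adj[OF x lattice_adj_step, of 0 k] by (auto simp: y_def)
  finally have "0 \<in> E" by (simp add: E_def)
  have "E \<subseteq> {v. l1_dist 0 v < n}" using z(3) by (force simp: E_def V_def agree_on_def not_le)
  then have "finite E" using finite_l1_ball finite_subset by blast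
  then have fin: "finite (coord_sum ` E)" "coord_sum ` E \<noteq> {}" using \<open>0 \<in> E\<close> by auto
  obtain v where v: "v \<in> E" "coord_sum v = Max (coord_sum ` E)"
    using Max_in[OF fin] by (metis imageE)
  obtain j where j: "x (v + axis j 1) = z v"
    using frozen[of "z v" v] colorings_range[OF z(1)] v(1) by (auto simp: E_def)
  have "v + axis j 1 \<notin> E"
  proof
    assume "v + axis j 1 \<in> E"
    then have "coord_sum (v + axis j 1) \<le> coord_sum v" using Max_ge[OF fin(1)] v(2) by simp
    then show False by (simp add: coord_sum_add)
  qed
  then have "z (v + axis j 1) = z v" using j by (simp add: E_def)
  then show False using colorings_adj[OF z(1) lattice_adj_step] by metis
qed

section \<open>Collapsing half-spaces to a chessboard\<close>

definition clamp :: "int \<Rightarrow> int \<Rightarrow> int" where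
  "clamp r a = max (- r) (min r a)"

text \<open>
  Overwrites the coordinate \<open>k\<close> of \<open>h\<close> by that element of \<open>{g, g + 1}\<close> which makes the
  coordinate sum congruent to \<open>s\<close> modulo \<open>2\<close>.
\<close>

definition with_parity :: "'d::finite \<Rightarrow> int \<Rightarrow> int \<Rightarrow> ('d \<Rightarrow> int) \<Rightarrow> int ^ 'd" where
  "with_parity k g s h = (\<chi> j. if j = k then g + (s - (\<Sum>i\<in>UNIV - {k}. h i) - g) mod 2 else h j)"

lemma with_parity_nth:
  "with_parity k g s h $ j = (if j = k then g + (s - (\<Sum>i\<in>UNIV - {k}. h i) - g) mod 2 else h j)"
  by (simp add: with_parity_def)

text \<open>If a coordinate other than \<open>k\<close> moves, it absorbs the change of parity and
  coordinate \<open>k\<close> stays. If none moves, coordinate \<open>k\<close> switches between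
  \<open>g\<close> and \<open>g + 1\<close>.\<close>

lemma with_parity_adj:
  fixes h h' :: "'d::finite \<Rightarrow> int"
  assumes one: "\<And>i j. \<lbrakk>i \<noteq> k; j \<noteq> k; h i \<noteq> h' i; h j \<noteq> h' j\<rbrakk> \<Longrightarrow> i = j"
    and near: "\<And>j. \<bar>h j - h' j\<bar> \<le> 1"
  shows "lattice_adj (with_parity k g s h) (with_parity k g (s + 1) h')"
proof (cases "\<exists>j. j \<noteq> k \<and> h j \<noteq> h' j")
  case True
  then obtain j where j: "j \<noteq> k" "h j \<noteq> h' j" by blast
  have same: "h' i = h i" if "i \<noteq> k" "i \<noteq> j" for i using one[of i j] j that by metis
  have "(\<Sum>i\<in>UNIV - {k}. h' i) = (\<Sum>i\<in>UNIV - {k}. h i + (if i = j then h' j - h j else 0))"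
    by (rule sum.cong) (auto simp: same)
  also have "\<dots> = (\<Sum>i\<in>UNIV - {k}. h i) + (h' j - h j)" using j(1) by (simp add: sum.distrib)
  finally have sum: "(\<Sum>i\<in>UNIV - {k}. h' i) = (\<Sum>i\<in>UNIV - {k}. h i) + (h' j - h j)" .
  have "h' j - h j = 1 \<or> h' j - h j = - 1" using near[of j] j(2) by linarith
  then have "(s + 1 - (\<Sum>i\<in>UNIV - {k}. h' i) - g) mod 2 = (s - (\<Sum>i\<in>UNIV - {k}. h i) - g) mod 2"
    unfolding sum by (elim disjE; presburger)
  then show ?thesis
    using \<open>h' j - h j = 1 \<or> h' j - h j = - 1\<close> j(1)
    by (intro lattice_adjI[of _ j]) (auto simp: with_parity_nth same)
next
  case False
  then have same: "h' i = h i" if "i \<noteq> k" for i using that by metis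
  then have sum: "(\<Sum>i\<in>UNIV - {k}. h' i) = (\<Sum>i\<in>UNIV - {k}. h i)" by (intro sum.cong) auto
  have mod2: "\<bar>(g + a mod 2) - (g + (a + 1) mod 2)\<bar> = 1" for a :: int
  proof -
    have "a mod 2 = 0 \<and> (a + 1) mod 2 = 1 \<or> a mod 2 = 1 \<and> (a + 1) mod 2 = 0" by presburger
    then show ?thesis by auto
  qed
  show ?thesis
    using mod2[of "s - (\<Sum>i\<in>UNIV - {k}. h i) - g"] same
    by (intro lattice_adjI[of _ k]) (auto simp: with_parity_nth sum algebra_simps)
qed

text \<open>For \<open>n \<ge> 0\<close> a ramp in \<open>t\<close>: constantly \<open>n\<close> up
  to \<open>n * r\<close>, then falling with slope one to 0 at \<open>n * r + n\<close>. Distinct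
  ranks fall on disjoint intervals.\<close>

definition radius :: "int \<Rightarrow> nat \<Rightarrow> int \<Rightarrow> int" where
  "radius n r t = max 0 (min n (n * int r + n - t))"

lemma radius_near: "0 \<le> n \<Longrightarrow> t \<le> 0 \<Longrightarrow> radius n r t = n"
proof -
  assume "0 \<le> n" "t \<le> 0"
  moreover have "0 \<le> n * int r" using \<open>0 \<le> n\<close> by (rule mult_nonneg_nonneg) simp
  ultimately have "n \<le> n * int r + n - t" by linarith
  then show ?thesis using \<open>0 \<le> n\<close> by (simp add: radius_def)
qed

lemma radius_far:
  assumes "0 \<le> n" "n * int d \<le> t" "r < d"
  shows "radius n r t = 0"
proof -
  have "n * (int r + 1) \<le> n * int d" using assms by (intro mult_left_mono) auto
  then show ?thesis using assms by (simp add: radius_def algebra_simps)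
qed

lemma radius_step: "\<bar>radius n r t - radius n r (t + 1)\<bar> \<le> 1"
  by (simp add: radius_def max_def min_def)

lemma radius_changes_once:
  assumes "0 \<le> n" "radius n r t \<noteq> radius n r (t + 1)" "radius n r' t \<noteq> radius n r' (t + 1)"
  shows "r = r'"
proof -
  have *: "n * int r \<le> t \<and> t < n * int r + n" if "radius n r t \<noteq> radius n r (t + 1)" for r
    using that by (simp add: radius_def max_def min_def split: if_splits)
  have "\<not> r < r'" if "radius n r t \<noteq> radius n r (t + 1)" "radius n r' t \<noteq> radius n r' (t + 1)" for r r'
  proof
    assume "r < r'"
    then have "n * (int r + 1) \<le> n * int r'" using assms(1) by (intro mult_left_mono) auto
    then show False using *[OF that(1)] *[OF that(2)] by (simp add: algebra_simps)
  qed
  from this[of r r'] this[of r' r] show ?thesis using assms(2,3) by linarith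
qed

text \<open>
  A graph homomorphism of the lattice that fixes the cube of radius \<open>n\<close> and, for large \<open>v\<^sub>k\<close>, maps
  into a single edge in direction \<open>k\<close>. As \<open>v\<^sub>k\<close> grows, the other coordinates are clamped
  to smaller and smaller intervals, one coordinate after the other in the order given by the ranks
  \<open>r\<close>; the coordinate \<open>k\<close> moves whenever none of the clamped coordinates does.
\<close>

definition collapse :: "'d::finite \<Rightarrow> int \<Rightarrow> ('d \<Rightarrow> nat) \<Rightarrow> int ^ 'd \<Rightarrow> int ^ 'd" where
  "collapse k n r v = with_parity k (min (v $ k) n) (coord_sum v)
     (\<lambda>j. clamp (radius n (r j) (v $ k - n)) (v $ j))"

text \<open>A sideways step moves at most one clamped coordinate, and so does a step in direction
  \<open>k\<close> from height \<open>n\<close> on, as at most one radius changes. Below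
  \<open>n\<close> all radii are \<open>n\<close>, and \<open>v $ k\<close> and the coordinate sum
  grow together, so just coordinate \<open>k\<close> moves, by one.\<close>

lemma collapse_adj:
  assumes n: "0 \<le> n" and r: "inj r"
  shows "lattice_adj (collapse k n r v) (collapse k n r (v + axis i 1))"
proof -
  consider "i \<noteq> k" | "i = k" "n \<le> v $ k" | "i = k" "v $ k < n" by linarith
  then show ?thesis
  proof cases
    case 1
    then have k: "(v + axis i 1) $ k = v $ k" by simp
    have "\<bar>clamp a b - clamp a (b + 1)\<bar> \<le> 1" for a b by (simp add: clamp_def max_def min_def)
    then show ?thesis unfolding collapse_def coord_sum_add coord_sum_axis k
      by (intro with_parity_adj) (auto split: if_splits)
  next
    case 2
    let ?R = "\<lambda>j. radius n (r j) (v $ k - n)" and ?R' = "\<lambda>j. radius n (r j) (v $ k - n + 1)"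
    have "\<bar>clamp a b - clamp a' b\<bar> \<le> \<bar>a - a'\<bar>" for a a' b
      unfolding clamp_def max_def min_def by (smt (verit))
    then have near: "\<bar>clamp (?R j) b - clamp (?R' j) b\<bar> \<le> 1" for j b
      using radius_step order_trans by blast
    have "lattice_adj (with_parity k n (coord_sum v) (\<lambda>j. clamp (?R j) (v $ j)))
      (with_parity k n (coord_sum v + 1) (\<lambda>j. clamp (?R' j) (v $ j)))"
    proof (rule with_parity_adj)
      fix i j assume "clamp (?R i) (v $ i) \<noteq> clamp (?R' i) (v $ i)" "clamp (?R j) (v $ j) \<noteq> clamp (?R' j) (v $ j)"
      then have "?R i \<noteq> ?R' i" "?R j \<noteq> ?R' j" by auto
      then have "r i = r j" using radius_changes_once[OF n] by blast
      then show "i = j" using r by (simp add: inj_eq)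
    qed (rule near)
    moreover have "with_parity k n (coord_sum v) (\<lambda>j. clamp (?R j) (v $ j)) = collapse k n r v"
      using 2 by (simp add: collapse_def)
    moreover have "with_parity k n (coord_sum v + 1) (\<lambda>j. clamp (?R' j) (v $ j)) = collapse k n r (v + axis i 1)"
    proof -
      have "(\<Sum>j\<in>UNIV - {k}. clamp (?R' j) ((v + axis k 1) $ j)) = (\<Sum>j\<in>UNIV - {k}. clamp (?R' j) (v $ j))"
        by (rule sum.cong) auto
      then show ?thesis
        using 2 by (auto simp: collapse_def vec_eq_iff with_parity_nth coord_sum_add algebra_simps)
    qed
    ultimately show ?thesis by simp
  next
    case 3
    have "(\<Sum>j\<in>UNIV - {k}. clamp n ((v + axis k 1) $ j)) = (\<Sum>j\<in>UNIV - {k}. clamp n (v $ j))"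
      by (rule sum.cong) auto
    then show ?thesis
      using 3 n by (intro lattice_adjI[of _ k])
        (simp_all add: collapse_def with_parity_nth radius_near coord_sum_add algebra_simps)
  qed
qed

lemma coord_sum_remove: "coord_sum v = v $ k + (\<Sum>j\<in>UNIV - {k}. v $ j)"
  by (simp add: coord_sum_def sum.remove)

text \<open>No clamp acts in the cube, and the coordinate sum already has the parity required, so
  the correction is 0.\<close>

lemma collapse_near:
  assumes v: "\<And>j. \<bar>v $ j\<bar> \<le> n"
  shows "collapse k n r v = v"
proof -
  have n: "0 \<le> n" using v[of k] by linarith
  have "clamp n (v $ j) = v $ j" for j using v[of j] by (simp add: clamp_def)
  moreover have "v $ k \<le> n" using v[of k] by linarith
  ultimately show ?thesis
    using n by (simp add: collapse_def vec_eq_iff with_parity_nth radius_near coord_sum_remove[of v k])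
qed

text \<open>The radii of all \<open>CARD('d)\<close> ranks, each taking \<open>n\<close> layers to
  fall, have reached 0 at this height.\<close>

lemma collapse_far:
  fixes v :: "int ^ 'd::finite"
  assumes n: "0 \<le> n" and r: "\<And>j. r j < CARD('d)" and v: "n + n * int CARD('d) \<le> v $ k"
  shows "collapse k n r v = axis k (n + (coord_sum v - n) mod 2)"
proof -
  have "radius n (r j) (v $ k - n) = 0" for j
    using radius_far[OF n _ r] v by simp
  moreover have "n \<le> v $ k" using v mult_nonneg_nonneg[OF n, of "int CARD('d)"] by simp
  ultimately show ?thesis
    by (simp add: collapse_def vec_eq_iff with_parity_nth axis_def clamp_def)
qed

text \<open>One parity class changes per layer: even sites to \<open>c\<close> at
  \<open>N + 1\<close>, odd sites to \<open>B\<close> at \<open>N + 2\<close>, even sites to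
  \<open>A\<close> at \<open>N + 3\<close>. A color \<open>c\<close> other than \<open>b\<close> and
  \<open>B\<close> exists by \<open>3 \<le> q\<close>.\<close>

lemma chessboard_recolor:
  assumes q: "3 \<le> q" and x: "x \<in> colorings q"
    and ab: "a \<noteq> b" "a \<in> {1..q}" "b \<in> {1..q}" and AB: "A \<noteq> B" "A \<in> {1..q}" "B \<in> {1..q}"
    and chess: "\<And>v. N \<le> v $ k \<Longrightarrow> x v = (if even (coord_sum v) then a else b)"
  shows "\<exists>z \<in> colorings q. (\<forall>v. v $ k \<le> N \<longrightarrow> z v = x v) \<and>
    (\<forall>v. N + 3 \<le> v $ k \<longrightarrow> z v = (if even (coord_sum v) then A else B))"
proof -
  have "card {b, B} < card {1..q}" using q by (auto simp: card_insert_if)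
  then obtain c where c: "c \<in> {1..q}" "c \<noteq> b" "c \<noteq> B"
    by (metis card_mono finite.emptyI finite.insertI insertI1 insertI2 leD subsetI)
  define e where "e s = (if s \<le> N then a else if s \<le> N + 2 then c else A)" for s
  define o' where "o' s = (if s \<le> N + 1 then b else B)" for s
  define z where "z v = (if v $ k \<le> N then x v else if even (coord_sum v) then e (v $ k) else o' (v $ k))" for v
  have e: "e s \<in> {1..q}" "o' s \<in> {1..q}" "e s \<noteq> o' s" "e s \<noteq> o' (s + 1)" "o' s \<noteq> e (s + 1)" for s
    using ab AB c by (auto simp: e_def o'_def)
  have z_far: "z v = (if even (coord_sum v) then e (v $ k) else o' (v $ k))" if "N \<le> v $ k" for v
    using that chess[of v] by (simp add: z_def e_def o'_def)
  have "z \<in> colorings q"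
  proof (rule coloringsI)
    fix v
    show "z v \<in> {1..q}" using e(1,2) colorings_range[OF x] by (simp add: z_def)
    fix i
    show "z v \<noteq> z (v + axis i 1)"
    proof (cases "N \<le> v $ k")
      case True
      then have "N \<le> (v + axis i 1) $ k" by auto
      then show ?thesis
        using z_far[OF True] z_far[of "v + axis i 1"] e(3)[of "v $ k"] e(4)[of "v $ k"] e(5)[of "v $ k"]
        by (cases "i = k") (auto simp: coord_sum_add)
    next
      case False
      then have "z v = x v" "z (v + axis i 1) = x (v + axis i 1)" by (auto simp: z_def)
      then show ?thesis using colorings_adj[OF x lattice_adj_step] by metis
    qed
  qed
  moreover have "z v = (if even (coord_sum v) then A else B)" if "N + 3 \<le> v $ k" for v
    using that by (simp add: z_def e_def o'_def)
  moreover have "z v = x v" if "v $ k \<le> N" for v using that by (simp add: z_def)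
  ultimately show ?thesis by blast
qed

text \<open>Pulling back along \<open>collapse\<close> leaves far out only the two colors of
  \<open>x\<close> on one edge; exchanging them for \<open>A\<close> and \<open>B\<close> costs
  three layers.\<close>

lemma chessboard_beyond_origin_cube:
  fixes x :: "int ^ 'd::finite \<Rightarrow> nat"
  assumes q: "3 \<le> q" and x: "x \<in> colorings q" and n: "0 \<le> n"
    and AB: "A \<noteq> B" "A \<in> {1..q}" "B \<in> {1..q}"
  shows "\<exists>z \<in> colorings q. (\<forall>v. (\<forall>j. \<bar>v $ j\<bar> \<le> n) \<longrightarrow> z v = x v) \<and>
    (\<forall>v. n + n * int CARD('d) + 3 \<le> v $ k \<longrightarrow> z v = (if even (coord_sum v) then A else B))"
proof -
  obtain r :: "'d \<Rightarrow> nat" where "bij_betw r UNIV {0..<CARD('d)}"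
    using ex_bij_betw_finite_nat[of "UNIV :: 'd set"] by auto
  then have r: "inj r" "\<And>j. r j < CARD('d)" by (auto simp: bij_betw_def)
  define N where "N = n + n * int CARD('d)"
  define x' where "x' v = x (collapse k n r v)" for v
  have x': "x' \<in> colorings q"
    unfolding x'_def by (rule colorings_pullback[OF x collapse_adj[OF n r(1)]])
  define f where "f b = x (axis k (n + (if b then 0 else 1)))" for b
  have "axis k (n + 1) = axis k n + axis k (1 :: int)" by (simp add: vec_eq_iff axis_def)
  then have f: "f True \<noteq> f False"
    using colorings_adj[OF x lattice_adj_step, of "axis k n" k] by (simp add: f_def)
  have far: "x' v = (if even (coord_sum v) then f (even n) else f (odd n))" if "N \<le> v $ k" for v
  proof -
    have "x' v = x (axis k (n + (coord_sum v - n) mod 2))"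
      unfolding x'_def by (subst collapse_far[OF n r(2)]) (use that in \<open>simp_all add: N_def\<close>)
    also have "(coord_sum v - n) mod 2 = (if even (coord_sum v) = even n then 0 else 1)"
      by presburger
    finally show ?thesis by (auto simp: f_def)
  qed
  have "f b \<in> {1..q}" for b unfolding f_def by (rule colorings_range[OF x])
  moreover have "f (even n) \<noteq> f (odd n)" using f by (cases "even n") auto
  ultimately obtain z where z: "z \<in> colorings q" "\<And>v. v $ k \<le> N \<Longrightarrow> z v = x' v"
      "\<And>v. N + 3 \<le> v $ k \<Longrightarrow> z v = (if even (coord_sum v) then A else B)"
    using chessboard_recolor[OF q x' _ _ _ AB far] by blast
  have "z v = x v" if "\<forall>j. \<bar>v $ j\<bar> \<le> n" for v
  proof -
    have "v $ k \<le> n" using that abs_le_D1 by blast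
    then have "v $ k \<le> N" using mult_nonneg_nonneg[OF n, of "int CARD('d)"] by (simp add: N_def)
    then show ?thesis using z(2) collapse_near[of v n k r] that by (simp add: x'_def)
  qed
  then show ?thesis using z(1,3) unfolding N_def by blast
qed

lemma chessboard_beyond_cube:
  fixes x :: "int ^ 'd::finite \<Rightarrow> nat" and p :: "int ^ 'd"
  assumes q: "3 \<le> q" and x: "x \<in> colorings q" and n: "0 \<le> n" and \<sigma>: "\<sigma> = 1 \<or> \<sigma> = - 1"
  shows "\<exists>z \<in> colorings q. (\<forall>v. (\<forall>j. \<bar>v $ j - p $ j\<bar> \<le> n) \<longrightarrow> z v = x v) \<and>
    (\<forall>v. n + n * int CARD('d) + 3 \<le> \<sigma> * (v $ k - p $ k) \<longrightarrow> z v = (if even (coord_sum v) then 1 else 2))"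
proof -
  define \<theta> where "\<theta> v = (\<chi> j. if j = k then p $ k + \<sigma> * v $ k else p $ j + v $ j)" for v
  define \<theta>' where "\<theta>' v = (\<chi> j. if j = k then \<sigma> * (v $ k - p $ k) else v $ j - p $ j)" for v
  have inv: "\<theta> (\<theta>' v) = v" for v using \<sigma> by (auto simp: \<theta>_def \<theta>'_def vec_eq_iff)
  have \<theta>: "lattice_adj (\<theta> i) (\<theta> (i + axis l 1))" for i l
    by (rule lattice_adjI[of _ l]) (use \<sigma> in \<open>auto simp: \<theta>_def algebra_simps\<close>)
  have \<theta>': "lattice_adj (\<theta>' i) (\<theta>' (i + axis l 1))" for i l
    by (rule lattice_adjI[of _ l]) (use \<sigma> in \<open>auto simp: \<theta>'_def algebra_simps\<close>)
  have parity: "even (coord_sum (\<theta>' v)) \<longleftrightarrow> even (coord_sum v) = even (coord_sum p)" for v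
  proof -
    have "coord_sum (\<theta>' v) = (\<Sum>j\<in>UNIV. (v $ j - p $ j) + (if j = k then (\<sigma> - 1) * (v $ k - p $ k) else 0))"
      unfolding coord_sum_def by (rule sum.cong) (auto simp: \<theta>'_def algebra_simps)
    also have "\<dots> = coord_sum v - coord_sum p + (\<sigma> - 1) * (v $ k - p $ k)"
      by (simp add: sum.distrib sum_subtractf coord_sum_def)
    finally show ?thesis using \<sigma> by auto
  qed
  \<comment> \<open>Swapping the colors with the parity of \<open>p\<close> makes the final
    chessboard independent of the cube, so that two of them match.\<close>
  define A B :: nat where "A = (if even (coord_sum p) then 1 else 2)" and "B = (if even (coord_sum p) then 2 else 1)"
  have "A \<noteq> B" "A \<in> {1..q}" "B \<in> {1..q}" using q by (auto simp: A_def B_def)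
  then obtain z where z: "z \<in> colorings q" "\<And>v. \<forall>j. \<bar>v $ j\<bar> \<le> n \<Longrightarrow> z v = x (\<theta> v)"
      "\<And>v. n + n * int CARD('d) + 3 \<le> v $ k \<Longrightarrow> z v = (if even (coord_sum v) then A else B)"
    using chessboard_beyond_origin_cube[OF q colorings_pullback[OF x \<theta>] n, of A B k] by blast
  have "(\<lambda>v. z (\<theta>' v)) \<in> colorings q" by (rule colorings_pullback[OF z(1) \<theta>'])
  moreover have "z (\<theta>' v) = x v" if "\<forall>j. \<bar>v $ j - p $ j\<bar> \<le> n" for v
  proof -
    have "\<bar>\<theta>' v $ j\<bar> = \<bar>v $ j - p $ j\<bar>" for j using \<sigma> by (auto simp: \<theta>'_def)
    then have "\<forall>j. \<bar>\<theta>' v $ j\<bar> \<le> n" using that by simp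
    then show ?thesis using z(2) inv by simp
  qed
  moreover have "z (\<theta>' v) = (if even (coord_sum v) then 1 else 2)"
    if "n + n * int CARD('d) + 3 \<le> \<sigma> * (v $ k - p $ k)" for v
  proof -
    have "\<theta>' v $ k = \<sigma> * (v $ k - p $ k)" by (simp add: \<theta>'_def)
    then show ?thesis using z(3)[of "\<theta>' v"] that parity[of v] by (auto simp: A_def B_def)
  qed
  ultimately show ?thesis by (intro bexI[of _ "\<lambda>v. z (\<theta>' v)"]) blast+
qed

section \<open>Gluing and topological mixing\<close>

lemma glue_along_hyperplane:
  assumes x: "x \<in> colorings q" and y: "y \<in> colorings q"
    and "\<And>v. v $ k = N \<Longrightarrow> x v = (if even (coord_sum v) then a else b)"
    and "\<And>v. v $ k = N + 1 \<Longrightarrow> y v = (if even (coord_sum v) then a else b)"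
    and "a \<noteq> b"
  shows "(\<lambda>v. if v $ k \<le> N then x v else y v) \<in> colorings q"
proof (rule coloringsI)
  fix v
  show "(if v $ k \<le> N then x v else y v) \<in> {1..q}"
    using colorings_range[OF x] colorings_range[OF y] by simp
  fix i
  have "x v \<noteq> y (v + axis i 1)" if "v $ k \<le> N" "\<not> (v + axis i 1) $ k \<le> N"
  proof -
    \<comment> \<open>Only edges from layer \<open>N\<close> to layer \<open>N + 1\<close> cross the
      seam, and there both colorings follow one chessboard.\<close>
    have "i = k" "v $ k = N" using that by (auto split: if_splits)
    then show ?thesis using assms(3)[of v] assms(4)[of "v + axis i 1"] \<open>a \<noteq> b\<close> by (auto simp: coord_sum_add)
  qed
  moreover have "(v + axis i 1) $ k \<le> N \<Longrightarrow> v $ k \<le> N" by (auto split: if_splits)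
  ultimately show "(if v $ k \<le> N then x v else y v) \<noteq> (if (v + axis i 1) $ k \<le> N then x (v + axis i 1) else y (v + axis i 1))"
    using colorings_adj[OF x lattice_adj_step] colorings_adj[OF y lattice_adj_step] by auto
qed

lemma finite_in_cube:
  assumes "finite (U :: (int ^ 'd::finite) set)"
  shows "\<exists>n\<ge>0. \<forall>u\<in>U. \<forall>j. \<bar>u $ j\<bar> \<le> (n :: int)"
proof (intro exI conjI ballI allI)
  show "0 \<le> (\<Sum>u\<in>U. \<Sum>j\<in>UNIV. \<bar>u $ j\<bar>)" by (simp add: sum_nonneg)
  fix u j assume "u \<in> U"
  have "\<bar>u $ j\<bar> \<le> (\<Sum>j\<in>UNIV. \<bar>u $ j\<bar>)" by (rule member_le_sum) auto
  also have "\<dots> \<le> (\<Sum>u\<in>U. \<Sum>j\<in>UNIV. \<bar>u $ j\<bar>)"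
    by (rule member_le_sum) (use assms \<open>u \<in> U\<close> in \<open>auto simp: sum_nonneg\<close>)
  finally show "\<bar>u $ j\<bar> \<le> (\<Sum>u\<in>U. \<Sum>j\<in>UNIV. \<bar>u $ j\<bar>)" .
qed

lemma topologically_mixing_colorings:
  assumes q: "3 \<le> q"
  shows "topologically_mixing (colorings q :: (int ^ 'd::finite \<Rightarrow> nat) set)"
  unfolding topologically_mixing_def
proof (intro allI impI)
  fix U V :: "(int ^ 'd) set" assume UV: "finite U \<and> U \<noteq> {} \<and> finite V \<and> V \<noteq> {}"
  then obtain n where n: "0 \<le> n" "\<And>u j. u \<in> U \<union> V \<Longrightarrow> \<bar>u $ j\<bar> \<le> (n :: int)"
    using finite_in_cube[of "U \<union> V"] by auto
  define N where "N = n + n * int CARD('d) + 3"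
  \<comment> \<open>\<open>N\<close> layers of transition on either side, and one more because the
    seam uses two consecutive layers.\<close>
  define M where "M = 2 * N + 1"
  have "n \<le> N" using mult_nonneg_nonneg[OF n(1), of "int CARD('d)"] by (simp add: N_def)
  have glue: "\<exists>z\<in>colorings q. (\<forall>v. (\<forall>j. \<bar>v $ j - p $ j\<bar> \<le> n) \<longrightarrow> z v = x v) \<and>
      (\<forall>v. (\<forall>j. \<bar>v $ j - p' $ j\<bar> \<le> n) \<longrightarrow> z v = y v)"
    if x: "x \<in> colorings q" and y: "y \<in> colorings q" and far: "M \<le> p' $ k - p $ k"
    for x y and p p' :: "int ^ 'd" and k
  proof -
    obtain x' where x': "x' \<in> colorings q" "\<And>v. \<forall>j. \<bar>v $ j - p $ j\<bar> \<le> n \<Longrightarrow> x' v = x v"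
        "\<And>v. N \<le> v $ k - p $ k \<Longrightarrow> x' v = (if even (coord_sum v) then 1 else 2)"
      using chessboard_beyond_cube[OF q x n(1), of 1 p k] unfolding N_def by auto
    obtain y' where y': "y' \<in> colorings q" "\<And>v. \<forall>j. \<bar>v $ j - p' $ j\<bar> \<le> n \<Longrightarrow> y' v = y v"
        "\<And>v. N \<le> p' $ k - v $ k \<Longrightarrow> y' v = (if even (coord_sum v) then 1 else 2)"
      using chessboard_beyond_cube[OF q y n(1), of "- 1" p' k] unfolding N_def by auto
    have "(\<lambda>v. if v $ k \<le> p $ k + N then x' v else y' v) \<in> colorings q"
      by (rule glue_along_hyperplane[OF x'(1) y'(1), of k _ 1 2])
        (use x'(3) y'(3) far in \<open>auto simp: M_def\<close>)
    moreover have "v $ k \<le> p $ k + N" if "\<forall>j. \<bar>v $ j - p $ j\<bar> \<le> n" for v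
      using that[rule_format, of k] \<open>n \<le> N\<close> by linarith
    moreover have "\<not> v $ k \<le> p $ k + N" if "\<forall>j. \<bar>v $ j - p' $ j\<bar> \<le> n" for v
      using that[rule_format, of k] \<open>n \<le> N\<close> far unfolding M_def by linarith
    ultimately show ?thesis
      using x'(2) y'(2) by (intro bexI[of _ "\<lambda>v. if v $ k \<le> p $ k + N then x' v else y' v"]) auto
  qed
  \<comment> \<open>If all coordinates of \<open>i\<close> were below \<open>M\<close> in absolute
    value, points of the two sets would differ by at most \<open>2 * n + M\<close> in each
    coordinate.\<close>
  define n0 where "n0 = CARD('d) * nat (2 * n + M) + 1"
  show "\<exists>n. \<forall>i. n \<le> set_dist (translate U i) V \<longrightarrow>
    (\<forall>x\<in>colorings q. \<forall>y\<in>colorings q. \<exists>z\<in>colorings q. agree_on (translate U i) z x \<and> agree_on V z y)"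
  proof (intro exI[of _ n0] allI impI ballI)
    fix i and x y :: "int ^ 'd \<Rightarrow> nat"
    assume i: "n0 \<le> set_dist (translate U i) V" and x: "x \<in> colorings q" and y: "y \<in> colorings q"
    have U: "\<bar>w $ j - i $ j\<bar> \<le> n" if "w \<in> translate U i" for w j
      using that n(2) by (auto simp: translate_def)
    have V: "\<bar>w $ j - 0 $ j\<bar> \<le> n" if "w \<in> V" for w j using that n(2) by simp
    obtain k where k: "M \<le> \<bar>i $ k\<bar>"
    proof (rule ccontr)
      assume "\<not> thesis"
      then have small: "\<bar>i $ j\<bar> < M" for j using that by (meson not_le)
      obtain u v where u: "u \<in> translate U i" and v: "v \<in> V" using UV by (auto simp: translate_def)
      have "nat \<bar>u $ j - v $ j\<bar> \<le> nat (2 * n + M)" for j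
        using U[OF u, of j] V[OF v, of j] small[of j] by (intro nat_mono) simp
      then have "l1_dist u v \<le> CARD('d) * nat (2 * n + M)"
        using sum_bounded_above[of "UNIV :: 'd set" "\<lambda>j. nat \<bar>u $ j - v $ j\<bar>"] by (simp add: l1_dist_def)
      then show False using set_dist_le[OF u v] i by (simp add: n0_def)
    qed
    have "\<exists>z\<in>colorings q. (\<forall>v. (\<forall>j. \<bar>v $ j - i $ j\<bar> \<le> n) \<longrightarrow> z v = x v) \<and>
      (\<forall>v. (\<forall>j. \<bar>v $ j - 0 $ j\<bar> \<le> n) \<longrightarrow> z v = y v)"
    proof (cases "M \<le> i $ k")
      case True
      then show ?thesis using glue[OF y x, of i k 0] by auto
    next
      case False
      then show ?thesis using k glue[OF x y, of 0 k i] by auto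
    qed
    then show "\<exists>z\<in>colorings q. agree_on (translate U i) z x \<and> agree_on V z y"
      unfolding agree_on_def using U V by blast
  qed
qed

section \<open>List coloring of blocks\<close>

text \<open>If every vertex with \<open>side\<close> has an out-neighbour in \<open>S\<close>, the
  opposite side is a kernel. Otherwise a sink \<open>a\<close> joins the kernel and is deleted
  together with its in-neighbours.\<close>

lemma bipartite_kernel_exists:
  fixes side :: "'a \<Rightarrow> bool"
  assumes bip: "\<And>u w. D u w \<Longrightarrow> side u \<noteq> side w" and "finite S"
  shows "\<exists>K\<subseteq>S. (\<forall>u\<in>K. \<forall>w\<in>K. \<not> D u w) \<and> (\<forall>u\<in>S - K. \<exists>w\<in>K. D u w)"
  using \<open>finite S\<close>
proof (induction S rule: finite_psubset_induct)
  case (psubset S)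
  show ?case
  proof (cases "\<forall>u\<in>S. side u \<longrightarrow> (\<exists>w\<in>S. D u w)")
    case True
    then show ?thesis using bip by (intro exI[of _ "{u\<in>S. \<not> side u}"]) blast
  next
    case False
    then obtain a where a: "a \<in> S" "\<And>w. w \<in> S \<Longrightarrow> \<not> D a w" by blast
    define S' where "S' = {u\<in>S. u \<noteq> a \<and> \<not> D u a}"
    have "S' \<subset> S" using a(1) by (auto simp: S'_def)
    then obtain K where K: "K \<subseteq> S'" "\<And>u w. u \<in> K \<Longrightarrow> w \<in> K \<Longrightarrow> \<not> D u w"
        "\<And>u. u \<in> S' - K \<Longrightarrow> \<exists>w\<in>K. D u w"
      using psubset.IH by metis
    have "\<not> D u w" if "u \<in> insert a K" "w \<in> insert a K" for u w
      using that a K(1,2) unfolding S'_def by blast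
    moreover have "\<exists>w\<in>insert a K. D u w" if "u \<in> S - insert a K" for u
      using that K(3)[of u] unfolding S'_def by blast
    moreover have "insert a K \<subseteq> S" using a(1) K(1) unfolding S'_def by blast
    ultimately show ?thesis by blast
  qed
qed

text \<open>
  Coloring a kernel of the subgraph of all vertices whose list contains \<open>a\<close> with \<open>a\<close> lowers
  the out-degree of every other vertex that thereby loses the color \<open>a\<close>.
\<close>

lemma bipartite_list_coloring:
  fixes side :: "'a \<Rightarrow> bool" and L :: "'a \<Rightarrow> 'c set"
  assumes bip: "\<And>u w. D u w \<Longrightarrow> side u \<noteq> side w" and "finite V"
    and "\<And>u. u \<in> V \<Longrightarrow> finite (L u)" and "\<And>u. u \<in> V \<Longrightarrow> card {w\<in>V. D u w} < card (L u)"
  shows "\<exists>c. (\<forall>u\<in>V. c u \<in> L u) \<and> (\<forall>u\<in>V. \<forall>w\<in>V. D u w \<longrightarrow> c u \<noteq> c w)"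
  using assms(2-4)
proof (induction V arbitrary: L rule: finite_psubset_induct)
  case (psubset V)
  show ?case
  proof (cases "V = {}")
    case False
    then obtain v where v: "v \<in> V" by blast
    then have "L v \<noteq> {}" using psubset.prems(2)[of v] by auto
    then obtain a where a: "a \<in> L v" by blast
    define S where "S = {u\<in>V. a \<in> L u}"
    have "finite S" using psubset.hyps by (simp add: S_def)
    then obtain K where K: "K \<subseteq> S" "\<And>u w. u \<in> K \<Longrightarrow> w \<in> K \<Longrightarrow> \<not> D u w"
        "\<And>u. u \<in> S - K \<Longrightarrow> \<exists>w\<in>K. D u w"
      using bipartite_kernel_exists[where D = D and side = side and S = S, OF bip] by metis
    \<comment> \<open>As \<open>a\<close> is in the list of \<open>v\<close>, the vertex
      \<open>v\<close> lies in \<open>K\<close> or points into it; thus the induction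
      descends.\<close>
    have "K \<noteq> {}" using K(3)[of v] v a by (auto simp: S_def)
    define V' where "V' = V - K"
    have V': "V' \<subset> V" using \<open>K \<noteq> {}\<close> K(1) by (auto simp: V'_def S_def)
    have "card {w\<in>V'. D u w} < card (L u - {a})" if u: "u \<in> V'" for u
    proof (cases "a \<in> L u")
      case True
      then obtain w where w: "w \<in> K" "D u w" using K(3)[of u] u by (auto simp: V'_def S_def)
      have "{w\<in>V'. D u w} \<subset> {w\<in>V. D u w}" using w K(1) by (auto simp: V'_def S_def)
      then have "card {w\<in>V'. D u w} < card {w\<in>V. D u w}"
        using psubset.hyps by (intro psubset_card_mono) auto
      also have "\<dots> \<le> card (L u - {a})"
        using psubset.prems(1)[of u] psubset.prems(2)[of u] u True by (simp add: V'_def)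
      finally show ?thesis .
    next
      case False
      have "card {w\<in>V'. D u w} \<le> card {w\<in>V. D u w}"
        using psubset.hyps by (intro card_mono) (auto simp: V'_def)
      then show ?thesis using False psubset.prems(2)[of u] u by (simp add: V'_def)
    qed
    moreover have "finite (L u - {a})" if "u \<in> V'" for u
      using psubset.prems(1) that by (simp add: V'_def)
    ultimately have "\<exists>c. (\<forall>u\<in>V'. c u \<in> L u - {a}) \<and> (\<forall>u\<in>V'. \<forall>w\<in>V'. D u w \<longrightarrow> c u \<noteq> c w)"
      by (intro psubset.IH[OF V'])
    then obtain c where c: "\<And>u. u \<in> V' \<Longrightarrow> c u \<in> L u - {a}"
        "\<And>u w. u \<in> V' \<Longrightarrow> w \<in> V' \<Longrightarrow> D u w \<Longrightarrow> c u \<noteq> c w"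
      by blast
    define c' where "c' u = (if u \<in> K then a else c u)" for u
    have "c' u \<in> L u" if "u \<in> V" for u
      using that c(1)[of u] K(1) by (auto simp: c'_def V'_def S_def)
    moreover have "c' u \<noteq> c' w" if "u \<in> V" "w \<in> V" "D u w" for u w
      using that c(1)[of u] c(1)[of w] c(2)[of u w] K(2)[of u w] by (auto simp: c'_def V'_def)
    ultimately show ?thesis by blast
  qed simp
qed

section \<open>Blocks of side \<open>d + 2\<close> and the finite extension property\<close>

lemma div_add_1_eq:
  fixes a m :: int
  assumes "0 < m" "a mod m \<noteq> m - 1"
  shows "(a + 1) div m = a div m" "(a + 1) mod m = a mod m + 1"
proof -
  have "0 \<le> a mod m" "a mod m < m" using assms(1) by simp_all
  then have b: "0 \<le> a mod m + 1" "a mod m + 1 < m" using assms by linarith+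
  have "a + 1 = m * (a div m) + (a mod m + 1)" by simp
  then show "(a + 1) div m = a div m" "(a + 1) mod m = a mod m + 1"
    using b int_div_pos_eq int_mod_pos_eq by blast+
qed

lemma div_diff_1_eq:
  fixes a m :: int
  assumes "0 < m" "a mod m \<noteq> 0"
  shows "(a - 1) div m = a div m"
proof -
  have "0 \<le> a mod m" "a mod m < m" using assms(1) by simp_all
  then have b: "0 \<le> a mod m - 1" "a mod m - 1 < m" using assms by linarith+
  have "a - 1 = m * (a div m) + (a mod m - 1)" by simp
  then show ?thesis using b int_div_pos_eq by blast
qed

definition block_index :: "int ^ 'd::finite \<Rightarrow> int ^ 'd" where
  "block_index v = (\<chi> j. v $ j div (int CARD('d) + 2))"

lemma finite_block: "finite (block_index -` {t :: int ^ 'd::finite})"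
proof (rule finite_subset)
  let ?m = "CARD('d) + 2"
  show "block_index -` {t} \<subseteq> (\<lambda>b. \<chi> j. int ?m * t $ j + b $ j) ` box ?m"
  proof
    fix v assume "v \<in> block_index -` {t}"
    then have t: "t $ j = v $ j div int ?m" for j by (auto simp: block_index_def algebra_simps)
    have b: "0 \<le> v $ j mod int ?m \<and> v $ j mod int ?m \<le> int ?m" for j
      by (simp add: order_less_imp_le)
    show "v \<in> (\<lambda>b. \<chi> j. int ?m * t $ j + b $ j) ` box ?m"
    proof (rule image_eqI[of _ _ "\<chi> j. v $ j mod int ?m"])
      show "v = (\<chi> j. int ?m * t $ j + (\<chi> j. v $ j mod int ?m) $ j)"
        unfolding vec_eq_iff vec_lambda_beta t by (simp only: mult_div_mod_eq simp_thms)
      show "(\<chi> j. v $ j mod int ?m) \<in> box ?m"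
        unfolding box_def mem_Collect_eq vec_lambda_beta atLeastAtMost_iff
      proof
        fix j
        show "- int ?m \<le> v $ j mod int ?m \<and> v $ j mod int ?m \<le> int ?m"
          using b[of j] by linarith
      qed
    qed
  qed
qed (simp add: finite_box)

text \<open>
  Inside a block, every line in direction \<open>j\<close> is oriented away from one of its interior points, its
  source. A vertex is the source of at most one of its lines, because the residue modulo \<open>d\<close> of the
  sum of the coordinates within the block determines the direction of the line; this needs \<open>d\<close> interior points per line,
  whence the side length \<open>d + 2\<close>. Then out-degree plus number of neighbours outside the
  block is at most \<open>d + 1\<close> everywhere.
\<close>

lemma block_extension:
  fixes S :: "(int ^ 'd::finite) set"
  assumes q: "CARD('d) + 2 \<le> q" and c: "proper_coloring_on q S c"
    and disj: "S \<inter> block_index -` {t} = {}"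
  shows "\<exists>c'. proper_coloring_on q (S \<union> block_index -` {t}) c' \<and> agree_on S c' c"
proof -
  define d where "d = int CARD('d)"
  define m where "m = d + 2"
  have d: "0 < d" by (simp add: d_def)
  then have m: "0 < m" by (simp add: m_def)
  define B where "B = block_index -` {t}"
  have B: "v \<in> B \<longleftrightarrow> (\<forall>j. v $ j div m = t $ j)" for v
    by (auto simp: B_def block_index_def vec_eq_iff m_def d_def)
  obtain idx :: "'d \<Rightarrow> nat" where idx: "bij_betw idx UNIV {0..<CARD('d)}"
    using ex_bij_betw_finite_nat[of "UNIV :: 'd set"] by auto
  define w where "w v j = v $ j mod m" for v :: "int ^ 'd" and j
  \<comment> \<open>The position from 1 to \<open>d\<close> on the line at which the sum of all
    positions \<open>w\<close> becomes congruent to \<open>idx j\<close> modulo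
    \<open>d\<close>.\<close>
  define src where "src v j = 1 + (int (idx j) - 1 - (\<Sum>i\<in>UNIV - {j}. w v i)) mod d" for v j
  have src: "1 \<le> src v j" "src v j \<le> d" for v j
    using pos_mod_sign[OF d, of "int (idx j) - 1 - (\<Sum>i\<in>UNIV - {j}. w v i)"]
      pos_mod_bound[OF d, of "int (idx j) - 1 - (\<Sum>i\<in>UNIV - {j}. w v i)"]
    unfolding src_def by linarith+
  have src_step: "src (v + axis j s) j = src v j" for v j s
  proof -
    have "(\<Sum>i\<in>UNIV - {j}. w (v + axis j s) i) = (\<Sum>i\<in>UNIV - {j}. w v i)"
      by (rule sum.cong) (auto simp: w_def axis_def)
    then show ?thesis by (simp add: src_def)
  qed
  have src_unique: "j = j'" if "w v j = src v j" "w v j' = src v j'" for v j j'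
  proof -
    have *: "(\<Sum>i\<in>UNIV. w v i) mod d = int (idx j)" if eq: "w v j = src v j" for j
    proof -
      have "(\<Sum>i\<in>UNIV. w v i) = w v j + (\<Sum>i\<in>UNIV - {j}. w v i)" by (simp add: sum.remove)
      then have "(int (idx j) - 1 - ((\<Sum>i\<in>UNIV. w v i) - w v j)) mod d = w v j - 1"
        using eq by (simp add: src_def)
      then have "(int (idx j) - 1 - ((\<Sum>i\<in>UNIV. w v i) - w v j)) mod d = (w v j - 1) mod d"
        by (metis mod_mod_trivial)
      then have "d dvd int (idx j) - (\<Sum>i\<in>UNIV. w v i)"
        by (simp add: mod_eq_dvd_iff algebra_simps)
      then have "int (idx j) mod d = (\<Sum>i\<in>UNIV. w v i) mod d" by (simp add: mod_eq_dvd_iff)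
      moreover have "idx j < CARD('d)" using idx by (auto simp: bij_betw_def)
      ultimately show ?thesis by (simp add: d_def)
    qed
    then have "idx j = idx j'" using that by (metis of_nat_eq_iff)
    then show ?thesis using idx by (auto simp: bij_betw_def inj_eq)
  qed
  \<comment> \<open>Both directions of a line are outgoing at its source, elsewhere only the one
    away from it. Steps leaving the block are included.\<close>
  define out where "out v = {(j, b). if b then src v j \<le> w v j else w v j \<le> src v j}" for v
  define step where "step v p = (case p of (j, b) \<Rightarrow> v + axis j (if b then 1 else - 1))"
    for v :: "int ^ 'd" and p
  define D where "D v u \<longleftrightarrow> u \<in> step v ` out v" for v u
  have card_out: "card (out v) \<le> CARD('d) + 1" for v
  proof -
    define E where "E = {j. w v j = src v j}"
    have "out v \<subseteq> (\<lambda>j. (j, src v j \<le> w v j)) ` UNIV \<union> (\<lambda>j. (j, False)) ` E"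
      by (auto simp: out_def E_def image_iff split: if_splits)
    then have "card (out v) \<le> card ((\<lambda>j. (j, src v j \<le> w v j)) ` UNIV \<union> (\<lambda>j. (j, False)) ` E)"
      by (intro card_mono) auto
    also have "\<dots> \<le> card ((\<lambda>j. (j, src v j \<le> w v j)) ` UNIV) + card ((\<lambda>j. (j, False)) ` E)"
      by (rule card_Un_le)
    also have "\<dots> \<le> CARD('d) + card E"
      by (intro add_mono card_image_le) auto
    also have "card E \<le> 1"
      unfolding One_nat_def by (subst card_le_Suc0_iff_eq) (use src_unique in \<open>auto simp: E_def\<close>)
    finally show ?thesis by simp
  qed
  have D_adj: "lattice_adj v u" if "D v u" for v u
  proof -
    have "u \<in> {u. lattice_adj v u}"
      using that unfolding neighbours_eq D_def step_def by (auto simp: case_prod_beta)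
    then show ?thesis by simp
  qed
  have adj_D: "D v u \<or> D u v" if adj: "lattice_adj v u" for v u
  proof -
    have *: "D v (v + axis j 1) \<or> D (v + axis j 1) v" for v j
    proof (cases "src v j \<le> w v j")
      case True
      then have "D v (v + axis j 1)"
        unfolding D_def by (intro image_eqI[of _ _ "(j, True)"]) (auto simp: out_def step_def)
      then show ?thesis ..
    next
      case False
      then have "v $ j mod m \<noteq> m - 1" using src(2)[of v j] by (simp add: w_def m_def)
      then have "w (v + axis j 1) j = w v j + 1" using m by (simp add: w_def div_add_1_eq)
      then have "(j, False) \<in> out (v + axis j 1)" using False by (simp add: out_def src_step)
      moreover have "v = step (v + axis j 1) (j, False)" by (simp add: step_def vec_eq_iff axis_def)
      ultimately show ?thesis unfolding D_def by blast
    qed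
    show ?thesis using adj *[of v] *[of u] unfolding lattice_adj_def by blast
  qed
  \<comment> \<open>A block is left from position 0 or \<open>m - 1\<close>; sources lie strictly
    between, so such a step points away from the source.\<close>
  have outside: "{u. lattice_adj v u \<and> u \<notin> B} \<subseteq> step v ` out v" if v: "v \<in> B" for v
  proof
    fix u assume "u \<in> {u. lattice_adj v u \<and> u \<notin> B}"
    then have "u \<in> {u. lattice_adj v u}" and uB: "u \<notin> B" by auto
    then obtain j b where u: "u = step v (j, b)"
      unfolding neighbours_eq step_def by auto
    have "u $ j div m \<noteq> v $ j div m"
    proof
      assume "u $ j div m = v $ j div m"
      then have "u $ i div m = v $ i div m" for i by (cases "i = j") (simp_all add: u step_def axis_def)
      then show False using uB v by (simp add: B)
    qed
    then have "w v j = (if b then m - 1 else 0)"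
      using div_add_1_eq(1)[OF m, of "v $ j"] div_diff_1_eq[OF m, of "v $ j"]
      by (cases b) (auto simp: u step_def w_def)
    then have "(j, b) \<in> out v" using src[of v j] by (auto simp: out_def m_def)
    then show "u \<in> step v ` out v" using u by blast
  qed
  have finB: "finite B" using finite_block by (simp add: B_def)
  define L where "L v = {1..q} - c ` {u\<in>S. lattice_adj v u}" for v
  have deg: "card {u\<in>B. D v u} < card (L v)" if v: "v \<in> B" for v
  proof -
    define N where "N = {u. lattice_adj v u \<and> u \<notin> B}"
    have fin: "finite (out v)" by simp
    have finN: "finite N" using finite_neighbours[of v] by (auto simp: N_def)
    \<comment> \<open>\<open>N\<close> takes up part of the bound on \<open>out v\<close>, so each
      color lost to an outside neighbour is paid for by a smaller out-degree within the
      block.\<close>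
    have "card {u\<in>B. D v u} + card N = card ({u\<in>B. D v u} \<union> N)"
      using finB finN by (intro card_Un_disjoint[symmetric]) (auto simp: N_def)
    also have "\<dots> \<le> card (step v ` out v)"
      using outside[OF v] fin by (intro card_mono) (auto simp: D_def N_def)
    also have "\<dots> \<le> CARD('d) + 1" using card_image_le[OF fin] card_out by (rule order_trans)
    finally have "card {u\<in>B. D v u} + card N \<le> CARD('d) + 1" .
    moreover have "q - card N \<le> card (L v)"
    proof -
      have sub: "{u\<in>S. lattice_adj v u} \<subseteq> N" using disj by (auto simp: N_def B_def)
      have "card (c ` {u\<in>S. lattice_adj v u}) \<le> card {u\<in>S. lattice_adj v u}"
        using finN sub by (intro card_image_le) (rule finite_subset)
      also have "\<dots> \<le> card N" using finN sub by (rule card_mono)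
      finally have "q - card N \<le> card {1..q} - card (c ` {u\<in>S. lattice_adj v u})" by simp
      also have "\<dots> \<le> card (L v)"
        unfolding L_def using finN sub by (intro diff_card_le_card_Diff finite_imageI) (rule finite_subset)
      finally show ?thesis .
    qed
    ultimately show ?thesis using q by linarith
  qed
  have bip: "even (coord_sum v) \<noteq> even (coord_sum u)" if "D v u" for v u
    using D_adj[OF that] by (auto simp: lattice_adj_def coord_sum_add)
  have "\<exists>g. (\<forall>v\<in>B. g v \<in> L v) \<and> (\<forall>v\<in>B. \<forall>u\<in>B. D v u \<longrightarrow> g v \<noteq> g u)"
    by (rule bipartite_list_coloring[where side = "\<lambda>v. even (coord_sum v)", OF bip finB _ deg])
      (simp_all add: L_def)
  then obtain g where g: "\<And>v. v \<in> B \<Longrightarrow> g v \<in> L v"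
      "\<And>v u. v \<in> B \<Longrightarrow> u \<in> B \<Longrightarrow> D v u \<Longrightarrow> g v \<noteq> g u"
    by blast
  define c' where "c' v = (if v \<in> B then g v else c v)" for v
  have "proper_coloring_on q (S \<union> B) c'"
    unfolding proper_coloring_on_def
  proof (intro conjI ballI impI)
    fix v u assume v: "v \<in> S \<union> B" and u: "u \<in> S \<union> B"
    show "c' v \<in> {1..q}" using g(1)[of v] v c by (auto simp: c'_def L_def proper_coloring_on_def)
    assume adj: "lattice_adj v u"
    have gc: "g a \<noteq> c b" if "a \<in> B" "b \<in> S" "lattice_adj a b" for a b
      using g(1)[OF that(1)] that(2,3) by (auto simp: L_def)
    show "c' v \<noteq> c' u"
    proof (cases "v \<in> B"; cases "u \<in> B")
      assume "v \<in> B" "u \<in> B"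
      then show ?thesis using g(2) adj_D[OF adj] by (metis c'_def)
    next
      assume "v \<in> B" "u \<notin> B"
      then show ?thesis using gc[of v u] u adj by (auto simp: c'_def)
    next
      assume "v \<notin> B" "u \<in> B"
      then show ?thesis using gc[of u v] v adj lattice_adj_sym[of v u] by (auto simp: c'_def)
    next
      assume "v \<notin> B" "u \<notin> B"
      then show ?thesis using c v u adj by (auto simp: c'_def proper_coloring_on_def)
    qed
  qed
  moreover have "agree_on S c' c" using disj by (auto simp: agree_on_def c'_def B_def)
  ultimately show ?thesis unfolding B_def by blast
qed

text \<open>Sites of one block differ by at most \<open>d + 1\<close> in each coordinate, so the
  thickened set contains every block meeting \<open>U\<close>. The given coloring is kept on these
  blocks and the others are filled in.\<close>

lemma finite_extension_property_colorings:
  assumes q: "CARD('d::finite) + 2 \<le> q"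
  shows "finite_extension_property TYPE('d) q (CARD('d) + 1)"
  unfolding finite_extension_property_def
proof (intro allI impI, elim conjE exE)
  fix U :: "(int ^ 'd) set" and u v
  assume v: "proper_coloring_on q (thicken U (CARD('d) + 1)) v" and agree: "agree_on U v u"
  define T where "T = block_index ` U"
  have "block_index -` T \<subseteq> thicken U (CARD('d) + 1)"
  proof
    fix a assume "a \<in> block_index -` T"
    then obtain b where b: "b \<in> U" "block_index a = block_index b" by (auto simp: T_def)
    define m where "m = int CARD('d) + 2"
    have "- int (CARD('d) + 1) \<le> (a - b) $ j \<and> (a - b) $ j \<le> int (CARD('d) + 1)" for j
    proof -
      have "a $ j div m = b $ j div m" using b(2) by (simp add: block_index_def vec_eq_iff m_def)
      then have "a $ j - b $ j = a $ j mod m - b $ j mod m"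
        by (simp add: minus_mult_div_eq_mod[symmetric])
      moreover have "0 \<le> a $ j mod m" "a $ j mod m < m" "0 \<le> b $ j mod m" "b $ j mod m < m"
        by (simp_all add: m_def)
      moreover have "int (CARD('d) + 1) = m - 1" by (simp add: m_def)
      ultimately show ?thesis unfolding vector_minus_component by linarith
    qed
    then have "a - b \<in> box (CARD('d) + 1)" by (simp only: box_def mem_Collect_eq atLeastAtMost_iff simp_thms)
    moreover have "a = b + (a - b)" by simp
    ultimately show "a \<in> thicken U (CARD('d) + 1)" using b(1) unfolding thicken_def by blast
  qed
  then have "proper_coloring_on q (block_index -` T) v"
    using v unfolding proper_coloring_on_def by blast
  then obtain z where z: "z \<in> colorings q" "agree_on (block_index -` T) z v"
    using extend_by_blocks[of q block_index T v] block_extension[OF q] by blast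
  then have "agree_on U z u" using agree by (auto simp: agree_on_def T_def)
  then show "\<exists>z\<in>colorings q. agree_on U z u" using z(1) by blast
qed

theorem theorem4p4:
  fixes q :: nat and X :: "(int ^ 'd::finite \<Rightarrow> nat) set"
  assumes "X = colorings q"
  shows "(3 \<le> q \<and> q \<le> CARD('d) + 1 \<longrightarrow>
            topologically_mixing X \<and> \<not> (\<exists>n. strongly_irreducible X n)) \<and>
         (CARD('d) + 2 \<le> q \<and> q \<le> 2 * CARD('d) \<longrightarrow>
            (\<exists>n. finite_extension_property TYPE('d) q n) \<and>
            \<not> (\<exists>n. topologically_strong_spatial_mixing X n)) \<and>
         (2 * CARD('d) + 1 \<le> q \<longrightarrow>
            (\<exists>n. topologically_strong_spatial_mixing X n))"
proof (intro conjI impI)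
  show "topologically_mixing X" if "3 \<le> q \<and> q \<le> CARD('d) + 1"
    using topologically_mixing_colorings that assms by blast
  show "\<not> (\<exists>n. strongly_irreducible X n)" if "3 \<le> q \<and> q \<le> CARD('d) + 1"
    using not_strongly_irreducible_colorings[where 'd = 'd, of q] that assms by auto
  show "\<exists>n. finite_extension_property TYPE('d) q n" if "CARD('d) + 2 \<le> q \<and> q \<le> 2 * CARD('d)"
    using finite_extension_property_colorings that by blast
  \<comment> \<open>The range of \<open>q\<close> forces \<open>CARD('d) \<ge> 2\<close>, whence
    \<open>4 \<le> q\<close>.\<close>
  show "\<not> (\<exists>n. topologically_strong_spatial_mixing X n)" if "CARD('d) + 2 \<le> q \<and> q \<le> 2 * CARD('d)"
    using not_tssm_colorings[where 'd = 'd, of q] that assms by auto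
  show "\<exists>n. topologically_strong_spatial_mixing X n" if "2 * CARD('d) + 1 \<le> q"
    using tssm_colorings that assms by blast
qed

end
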